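(* Let $\theta$ be an action of an inverse semigroup $S$ on a locally compact Hausdorff space $X$. The following hold. (i) For every character $\chi$ on $E(S)\ltimes^{\mathrm{KS}}C_0(X)$, there exists a unique element $\tau_\chi\in\prod_{e\in E(S)}\widetilde{X_e}$ satisfying $g(\tau_\chi(e))=\chi(\delta_e\,g)$ for all $e\in E(S)$ and $g\in C_0(X_e)$. Moreover, $\tau_\chi\in X^{\mathrm{KS}}$. (ii) For every $\tau\in X^{\mathrm{KS}}$, there exists a unique character $\chi_\tau\colon E(S)\ltimes^{\mathrm{KS}}C_0(X)\to\mathbb C$ such that $\chi_\tau(\delta_e\,g)=g(\tau(e))$ for all $e\in E(S)$ and $g\in C_0(X_e)$. (iii) The correspondences $$\mathrm{Sp}(E(S)\ltimes^{\mathrm{KS}}C_0(X))\ni\chi\mapsto\tau_\chi\in X^{\mathrm{KS}},\qquad X^{\mathrm{KS}}\ni\tau\mapsto\chi_\tau\in\mathrm{Sp}(E(S)\ltimes^{\mathrm{KS}}C_0(X))$$ are inverses of each other, and are homeomorphisms between $\mathrm{Sp}(E(S)\ltimes^{\mathrm{KS}}C_0(X))$ and $X^{\mathrm{KS}}$.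
   Context: An inverse semigroup is a semigroup $S$ in which every $s$ has a unique $s^*$ with $ss^*s=s$, $s^*ss^*=s^*$; $E(S)$ is its commutative subsemigroup of idempotents; $s\le t$ means $ts^*s=s$ (so for idempotents $e\le f$ iff $ef=e$). An action $\theta$ of $S$ on a topological space $X$ is a semigroup homomorphism $s\mapsto\theta_s$ from $S$ to the inverse semigroup of partial bijections of $X$ (bijections between subsets, composed on the largest possible domain) such that, writing $X_e$ for the subset on which $\theta_e$ ($e\in E(S)$) is the identity (so $\theta_s$ is a bijection $X_{s^*s}\to X_{ss^*}$): each $X_e$ is open, each $\theta_s\colon X_{s^*s}\to X_{ss^*}$ is continuous, and $\bigcup_{e\in E(S)}X_e=X$. The space $X^{\mathrm{KS}}$: let $\widetilde{X_e}=X_e\sqcup\{\infty_e\}$ be the one-point compactification of $X_e$ (a point $\infty_e$ is added even when $X_e$ is compact). Let $\widetilde{X^{\mathrm{KS}}}$ be the set of $\tau\in\prod_{e\in E(S)}\widetilde{X_e}$ such that (1) if $e_1\le e_2$ and $\tau(e_1)\ne\infty_{e_1}$, then $\tau(e_2)=\tau(e_1)$; (2) if $\tau(e_1)\neq\infty_{e_1}$ and $\tau(e_2)\neq\infty_{e_2}$, then $\tau(e_1e_2)\neq\infty_{e_1e_2}$; with the topology induced from the product topology. Set $X^{\mathrm{KS}}=\widetilde{X^{\mathrm{KS}}}\setminus\{\infty\}$, $\infty=(\infty_e)_{e\in E(S)}$. Functions $g\in C_0(X_e)$ are extended to $\widetilde{X_e}$ by $g(\infty_e)=0$. The commutative C*-algebra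 $E(S)\ltimes^{\mathrm{KS}}C_0(X)$: view $C_0(X_e)$ as an ideal of $C_0(X)$. Let $E(S)\ltimes^{\mathrm{KS}}_{\mathrm{alg}}C_0(X)=\bigoplus_{e\in E(S)}C_0(X_e)$ (algebraic direct sum), with $\delta_e\,g$ the element having $g\in C_0(X_e)$ in the $e$-th component and $0$ elsewhere; it is a $*$-algebra with $(\delta_e g)(\delta_f h)=\delta_{ef}\,gh$ and $(\delta_e g)^*=\delta_e\,\overline g$. $E(S)\ltimes^{\mathrm{KS}}C_0(X)$ is its universal enveloping C*-algebra. $\mathrm{Sp}(B)$ denotes the space of characters (nonzero $*$-homomorphisms to $\mathbb C$) of a commutative C*-algebra $B$ with the topology of pointwise convergence. *)

theory Defs
  imports "HOL-Analysis.Analysis"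
begin

section \<open>Inverse semigroups and their actions\<close>

class inverse_semigroup = semigroup_mult +
  assumes ex1_generalized_inverse: "\<exists>!t. s * t * s = s \<and> t * s * t = t"

definition sinv :: "'s::inverse_semigroup \<Rightarrow> 's" where
  "sinv s = (THE t. s * t * s = s \<and> t * s * t = t)"

definition idempotents :: "'s::inverse_semigroup set" where
  "idempotents = {e. e * e = e}"

definition natural_le :: "'s::inverse_semigroup \<Rightarrow> 's \<Rightarrow> bool" where
  "natural_le s t \<longleftrightarrow> t * sinv s * s = s"

(* Partial maps are modelled as in theory Map; map_comp is composition on the largest
   possible domain. *)
definition partial_bijection_on :: "'x set \<Rightarrow> ('x \<Rightarrow> 'x option) \<Rightarrow> bool" where
  "partial_bijection_on A f \<longleftrightarrow> dom f \<subseteq> A \<and> ran f \<subseteq> A \<and> inj_on f (dom f)"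

definition act_dom :: "('s \<Rightarrow> 'x \<Rightarrow> 'x option) \<Rightarrow> 's::inverse_semigroup \<Rightarrow> 'x set" where
  "act_dom \<theta> e = {x. \<theta> e x = Some x}"

definition semigroup_action ::
  "'x topology \<Rightarrow> ('s::inverse_semigroup \<Rightarrow> 'x \<Rightarrow> 'x option) \<Rightarrow> bool" where
  "semigroup_action X \<theta> \<longleftrightarrow>
     (\<forall>s. partial_bijection_on (topspace X) (\<theta> s)) \<and>
     (\<forall>s t. \<theta> (s * t) = \<theta> s \<circ>\<^sub>m \<theta> t) \<and>
     (\<forall>e\<in>idempotents. openin X (act_dom \<theta> e)) \<and>
     (\<forall>s. continuous_map (subtopology X (act_dom \<theta> (sinv s * s)))
                         (subtopology X (act_dom \<theta> (s * sinv s))) (\<lambda>x. the (\<theta> s x))) \<and>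
     (\<Union>e\<in>idempotents. act_dom \<theta> e) = topspace X"

abbreviation act_space ::
  "'x topology \<Rightarrow> ('s \<Rightarrow> 'x \<Rightarrow> 'x option) \<Rightarrow> 's::inverse_semigroup \<Rightarrow> 'x topology" where
  "act_space X \<theta> e \<equiv> subtopology X (act_dom \<theta> e)"

section \<open>Functions vanishing at infinity and the space X-KS\<close>

(* Functions are extended by zero outside the space. For an open subspace Y of X this is
   exactly the usual identification of C_0(Y) with an ideal of C_0(X). *)
definition C0 :: "'x topology \<Rightarrow> ('x \<Rightarrow> complex) set" where
  "C0 Y = {g. continuous_map Y euclidean g \<and>
              (\<forall>\<epsilon>>0. compactin Y {x \<in> topspace Y. \<epsilon> \<le> cmod (g x)}) \<and>
              (\<forall>x. x \<notin> topspace Y \<longrightarrow> g x = 0)}"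

(* None is the point at infinity; Alexandroff_compactification adds it (as an isolated
   point) also to a compact space. *)
definition ext_infty :: "('x \<Rightarrow> complex) \<Rightarrow> 'x option \<Rightarrow> complex" where
  "ext_infty g v = (case v of None \<Rightarrow> 0 | Some x \<Rightarrow> g x)"

definition KS_product ::
  "'x topology \<Rightarrow> ('s::inverse_semigroup \<Rightarrow> 'x \<Rightarrow> 'x option) \<Rightarrow> ('s \<Rightarrow> 'x option) topology" where
  "KS_product X \<theta> =
     product_topology (\<lambda>e. Alexandroff_compactification (act_space X \<theta> e)) idempotents"

definition KS_space_tilde ::
  "'x topology \<Rightarrow> ('s::inverse_semigroup \<Rightarrow> 'x \<Rightarrow> 'x option) \<Rightarrow> ('s \<Rightarrow> 'x option) topology" where
  "KS_space_tilde X \<theta> = subtopology (KS_product X \<theta>)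
     {\<tau>. (\<forall>e\<in>idempotents. \<forall>f\<in>idempotents.
            natural_le e f \<and> \<tau> e \<noteq> None \<longrightarrow> \<tau> f = \<tau> e) \<and>
         (\<forall>e\<in>idempotents. \<forall>f\<in>idempotents.
            \<tau> e \<noteq> None \<and> \<tau> f \<noteq> None \<longrightarrow> \<tau> (e * f) \<noteq> None)}"

definition KS_space ::
  "'x topology \<Rightarrow> ('s::inverse_semigroup \<Rightarrow> 'x \<Rightarrow> 'x option) \<Rightarrow> ('s \<Rightarrow> 'x option) topology" where
  "KS_space X \<theta> = subtopology (KS_space_tilde X \<theta>) (- {\<lambda>e\<in>idempotents. None})"

section \<open>Enveloping C*-algebras and spectra\<close>

record 'a star_algebra =
  sa_carrier :: "'a set"
  sa_add :: "'a \<Rightarrow> 'a \<Rightarrow> 'a"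
  sa_scale :: "complex \<Rightarrow> 'a \<Rightarrow> 'a"
  sa_mult :: "'a \<Rightarrow> 'a \<Rightarrow> 'a"
  sa_star :: "'a \<Rightarrow> 'a"

record 'a cstar_algebra = "'a star_algebra" +
  cs_norm :: "'a \<Rightarrow> real"

definition cstar_seminorm :: "('a, 'm) star_algebra_scheme \<Rightarrow> ('a \<Rightarrow> real) \<Rightarrow> bool" where
  "cstar_seminorm A p \<longleftrightarrow>
     (\<forall>a\<in>sa_carrier A. 0 \<le> p a) \<and>
     (\<forall>a\<in>sa_carrier A. \<forall>b\<in>sa_carrier A. p (sa_add A a b) \<le> p a + p b) \<and>
     (\<forall>c. \<forall>a\<in>sa_carrier A. p (sa_scale A c a) = cmod c * p a) \<and>
     (\<forall>a\<in>sa_carrier A. \<forall>b\<in>sa_carrier A. p (sa_mult A a b) \<le> p a * p b) \<and>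
     (\<forall>a\<in>sa_carrier A. p (sa_mult A (sa_star A a) a) = (p a)\<^sup>2)"

(* The C*-seminorms are exactly the pullbacks of norms along *-homomorphisms into
   C*-algebras (equivalently, along *-representations on Hilbert spaces). The supremum is
   meaningful only where it is finite; that is the standing condition for an enveloping
   C*-algebra to exist. It holds for KS_alg below, because a C*-seminorm restricted to a
   summand C_0(X_e) is dominated by the supremum norm. *)
definition universal_seminorm :: "('a, 'm) star_algebra_scheme \<Rightarrow> 'a \<Rightarrow> real" where
  "universal_seminorm A a = (SUP p\<in>{p. cstar_seminorm A p}. p a)"

(* The enveloping C*-algebra is the Hausdorff completion of A in the universal seminorm:
   Cauchy sequences modulo sequences at distance tending to zero. *)
definition sa_dist :: "('a, 'm) star_algebra_scheme \<Rightarrow> 'a \<Rightarrow> 'a \<Rightarrow> real" where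
  "sa_dist A a b = universal_seminorm A (sa_add A a (sa_scale A (-1) b))"

definition sa_Cauchy :: "('a, 'm) star_algebra_scheme \<Rightarrow> (nat \<Rightarrow> 'a) set" where
  "sa_Cauchy A = {u. range u \<subseteq> sa_carrier A \<and>
                     (\<forall>\<epsilon>>0. \<exists>N. \<forall>m\<ge>N. \<forall>n\<ge>N. sa_dist A (u m) (u n) < \<epsilon>)}"

definition sa_rel :: "('a, 'm) star_algebra_scheme \<Rightarrow> ((nat \<Rightarrow> 'a) \<times> (nat \<Rightarrow> 'a)) set" where
  "sa_rel A = {(u, v). u \<in> sa_Cauchy A \<and> v \<in> sa_Cauchy A \<and>
                       (\<lambda>n. sa_dist A (u n) (v n)) \<longlonglongrightarrow> 0}"

definition enveloping_cstar ::
  "('a, 'm) star_algebra_scheme \<Rightarrow> (nat \<Rightarrow> 'a) set cstar_algebra" where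
  "enveloping_cstar A =
     \<lparr> sa_carrier = sa_Cauchy A // sa_rel A,
       sa_add = (\<lambda>P Q. \<Union>u\<in>P. \<Union>v\<in>Q. sa_rel A `` {\<lambda>n. sa_add A (u n) (v n)}),
       sa_scale = (\<lambda>c P. \<Union>u\<in>P. sa_rel A `` {\<lambda>n. sa_scale A c (u n)}),
       sa_mult = (\<lambda>P Q. \<Union>u\<in>P. \<Union>v\<in>Q. sa_rel A `` {\<lambda>n. sa_mult A (u n) (v n)}),
       sa_star = (\<lambda>P. \<Union>u\<in>P. sa_rel A `` {\<lambda>n. sa_star A (u n)}),
       cs_norm = (\<lambda>P. THE r. \<exists>u\<in>P. (\<lambda>n. universal_seminorm A (u n)) \<longlonglongrightarrow> r) \<rparr>"

definition enveloping_map :: "('a, 'm) star_algebra_scheme \<Rightarrow> 'a \<Rightarrow> (nat \<Rightarrow> 'a) set" where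
  "enveloping_map A a = sa_rel A `` {\<lambda>_. a}"

(* Characters are extensional functions, so that equality of characters is equality of
   their restrictions to the carrier. *)
definition characters :: "('b, 'm) star_algebra_scheme \<Rightarrow> ('b \<Rightarrow> complex) set" where
  "characters B = {\<phi> \<in> extensional (sa_carrier B).
     (\<forall>a\<in>sa_carrier B. \<forall>b\<in>sa_carrier B. \<phi> (sa_add B a b) = \<phi> a + \<phi> b) \<and>
     (\<forall>c. \<forall>a\<in>sa_carrier B. \<phi> (sa_scale B c a) = c * \<phi> a) \<and>
     (\<forall>a\<in>sa_carrier B. \<forall>b\<in>sa_carrier B. \<phi> (sa_mult B a b) = \<phi> a * \<phi> b) \<and>
     (\<forall>a\<in>sa_carrier B. \<phi> (sa_star B a) = cnj (\<phi> a)) \<and>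
     (\<exists>a\<in>sa_carrier B. \<phi> a \<noteq> 0)}"

definition Sp :: "('b, 'm) star_algebra_scheme \<Rightarrow> ('b \<Rightarrow> complex) topology" where
  "Sp B = subtopology (product_topology (\<lambda>_. euclidean) (sa_carrier B)) (characters B)"

section \<open>The commutative C*-algebra of the action\<close>

definition KS_single :: "'s \<Rightarrow> ('x \<Rightarrow> complex) \<Rightarrow> 's \<Rightarrow> 'x \<Rightarrow> complex" where
  "KS_single e g = (\<lambda>f x. if f = e then g x else 0)"

definition KS_supp :: "('s \<Rightarrow> 'x \<Rightarrow> complex) \<Rightarrow> 's set" where
  "KS_supp a = {e. a e \<noteq> (\<lambda>_. 0)}"

(* The product is the bilinear extension of (delta_e g)(delta_f h) = delta_{ef} gh. *)
definition KS_alg ::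
  "'x topology \<Rightarrow> ('s::inverse_semigroup \<Rightarrow> 'x \<Rightarrow> 'x option) \<Rightarrow>
   ('s \<Rightarrow> 'x \<Rightarrow> complex) star_algebra" where
  "KS_alg X \<theta> =
     \<lparr> sa_carrier = {a. finite (KS_supp a) \<and> KS_supp a \<subseteq> idempotents \<and>
                        (\<forall>e\<in>idempotents. a e \<in> C0 (act_space X \<theta> e))},
       sa_add = (\<lambda>a b e x. a e x + b e x),
       sa_scale = (\<lambda>c a e x. c * a e x),
       sa_mult = (\<lambda>a b k x. \<Sum>e\<in>KS_supp a. \<Sum>f\<in>KS_supp b.
                    KS_single (e * f) (\<lambda>y. a e y * b f y) k x),
       sa_star = (\<lambda>a e x. cnj (a e x)) \<rparr>"

definition KS_cstar ::
  "'x topology \<Rightarrow> ('s::inverse_semigroup \<Rightarrow> 'x \<Rightarrow> 'x option) \<Rightarrow>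
   (nat \<Rightarrow> 's \<Rightarrow> 'x \<Rightarrow> complex) set cstar_algebra" where
  "KS_cstar X \<theta> = enveloping_cstar (KS_alg X \<theta>)"

definition KS_delta ::
  "'x topology \<Rightarrow> ('s::inverse_semigroup \<Rightarrow> 'x \<Rightarrow> 'x option) \<Rightarrow> 's \<Rightarrow> ('x \<Rightarrow> complex) \<Rightarrow>
   (nat \<Rightarrow> 's \<Rightarrow> 'x \<Rightarrow> complex) set" where
  "KS_delta X \<theta> e g = enveloping_map (KS_alg X \<theta>) (KS_single e g)"

definition KS_point ::
  "'x topology \<Rightarrow> ('s::inverse_semigroup \<Rightarrow> 'x \<Rightarrow> 'x option) \<Rightarrow>
   ((nat \<Rightarrow> 's \<Rightarrow> 'x \<Rightarrow> complex) set \<Rightarrow> complex) \<Rightarrow> 's \<Rightarrow> 'x option" where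
  "KS_point X \<theta> \<phi> = (THE \<tau>. \<tau> \<in> topspace (KS_product X \<theta>) \<and>
     (\<forall>e\<in>idempotents. \<forall>g\<in>C0 (act_space X \<theta> e). ext_infty g (\<tau> e) = \<phi> (KS_delta X \<theta> e g)))"

definition KS_char ::
  "'x topology \<Rightarrow> ('s::inverse_semigroup \<Rightarrow> 'x \<Rightarrow> 'x option) \<Rightarrow> ('s \<Rightarrow> 'x option) \<Rightarrow>
   (nat \<Rightarrow> 's \<Rightarrow> 'x \<Rightarrow> complex) set \<Rightarrow> complex" where
  "KS_char X \<theta> \<tau> = (THE \<phi>. \<phi> \<in> characters (KS_cstar X \<theta>) \<and>
     (\<forall>e\<in>idempotents. \<forall>g\<in>C0 (act_space X \<theta> e). \<phi> (KS_delta X \<theta> e g) = ext_infty g (\<tau> e)))"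

end

theory Submission
  imports Defs "HOL-Library.Function_Algebras"
begin

text \<open>A character of the algebra is determined by its values on the elements \<open>\<delta>\<^sub>e g\<close>. For fixed \<open>e\<close>,
  these values form a multiplicative functional on \<open>C0 (Y e)\<close>, where \<open>Y e\<close> is the open domain
  of \<open>e\<close>, so it is evaluation at a point of the one-point compactification
  (\<open>C0_multiplicative_functional_point\<close>). The multiplication rule of the algebra ties
  the points for different \<open>e\<close> together by the two conditions that define the space of the action;
  they make sense because idempotents of an inverse semigroup commute and are closed under
  multiplication. Conversely these conditions make the sum of the evaluations multiplicative
  (\<open>functional_mult\<close>).

  The passage between the algebraic direct sum and its enveloping C*-algebra needs three
  facts. The universal seminorm is finite, because on each summand a C*-seminorm is bounded by the
  supremum norm (\<open>C0_cstar_seminorm_le_sup\<close>). Every character of the direct sum extends, because its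
  absolute value is itself a C*-seminorm (\<open>character_extend\<close>). Every character of the
  completion is contractive, by the geometric series (\<open>character_contractive\<close>), so that it is
  determined by its restriction to the dense image, and cannot vanish there.

  Both topologies are topologies of pointwise convergence. On the spectrum it suffices to
  test on the dense image, as approximation is uniform over the contractive characters
  (\<open>continuous_map_into_Sp\<close>), hence on the elements \<open>\<delta>\<^sub>e g\<close>. On the other side the one-point
  compactification is compact and embeds into a product by means of the functions in \<open>C0 (Y e)\<close>
  (\<open>continuous_map_into_Alexandroff\<close>). The correspondence matches the test functions.\<close>

section \<open>Idempotents of an inverse semigroup\<close>

lemma sinv_eqI:
  fixes s :: "'s::inverse_semigroup"
  assumes "s * t * s = s" "t * s * t = t"
  shows "sinv s = t"
  unfolding sinv_def using assms ex1_generalized_inverse[of s] by (blast intro: the1_equality)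

lemma sinv_props:
  fixes s :: "'s::inverse_semigroup"
  shows "s * sinv s * s = s" "sinv s * s * sinv s = sinv s"
  unfolding sinv_def using theI'[OF ex1_generalized_inverse[of s]] by auto

lemma sinv_idempotent: "e \<in> idempotents \<Longrightarrow> sinv e = (e :: 's::inverse_semigroup)"
  by (rule sinv_eqI) (simp_all add: idempotents_def)

text \<open>If \<open>x\<close> is the inverse of \<open>ef\<close>, then so is \<open>fxe\<close>; hence \<open>x = fxe\<close>, which makes \<open>x\<close>
  idempotent and therefore equal to its own inverse \<open>ef\<close>.\<close>

lemma idempotents_mult:
  fixes e f :: "'s::inverse_semigroup"
  assumes "e \<in> idempotents" "f \<in> idempotents"
  shows "e * f \<in> idempotents"
proof -
  have ee: "e * e = e" "e * (e * y) = e * y" and ff: "f * f = f" "f * (f * y) = f * y" for y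
    using assms by (auto simp: idempotents_def simp flip: mult.assoc)
  define x where "x = sinv (e * f)"
  have x1: "e * (f * (x * (e * f))) = e * f" and x2: "x * (e * (f * x)) = x"
    using sinv_props[of "e * f"] by (simp_all add: x_def mult.assoc)
  have x2': "x * (e * (f * (x * y))) = x * y" for y
    using x2 by (metis mult.assoc)
  have "sinv (e * f) = f * x * e"
    by (rule sinv_eqI) (simp_all add: mult.assoc ee ff x1 x2')
  hence x: "x = f * x * e" by (simp add: x_def)
  have "x * x = (f * x * e) * (f * x * e)" using x by simp
  also have "\<dots> = f * x * e" by (simp add: mult.assoc x2')
  finally have xx: "x * x = x" using x by simp
  have "sinv x = x" using xx by (intro sinv_idempotent) (simp add: idempotents_def)
  moreover have "sinv x = e * f"
    by (rule sinv_eqI) (simp_all add: mult.assoc x1 x2)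
  ultimately show ?thesis using xx by (simp add: idempotents_def)
qed

lemma idempotents_commute:
  fixes e f :: "'s::inverse_semigroup"
  assumes "e \<in> idempotents" "f \<in> idempotents"
  shows "e * f = f * e"
proof -
  have ee: "e * e = e" "e * (e * y) = e * y" and ff: "f * f = f" "f * (f * y) = f * y" for y
    using assms by (auto simp: idempotents_def simp flip: mult.assoc)
  have ef: "e * (f * (e * f)) = e * f" "f * (e * (f * e)) = f * e"
    using idempotents_mult[OF assms] idempotents_mult[OF assms(2,1)]
    by (simp_all add: idempotents_def mult.assoc)
  have "sinv (e * f) = f * e"
    by (rule sinv_eqI) (simp_all add: mult.assoc ee ff ef)
  thus ?thesis using sinv_idempotent[OF idempotents_mult[OF assms]] by simp
qed

lemma natural_le_idempotents_iff:
  fixes e f :: "'s::inverse_semigroup"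
  assumes "e \<in> idempotents" "f \<in> idempotents"
  shows "natural_le e f \<longleftrightarrow> e * f = e"
proof -
  have "f * sinv e * e = f * (e * e)" using assms(1) by (simp only: sinv_idempotent mult.assoc)
  also have "e * e = e" using assms(1) by (simp add: idempotents_def)
  also have "f * e = e * f" using idempotents_commute[OF assms] by (rule sym)
  finally have "f * sinv e * e = e * f" .
  thus ?thesis by (simp add: natural_le_def)
qed

text \<open>An injective partial map that equals its own square is a partial identity.\<close>

lemma act_idempotent_fixes_range:
  assumes "semigroup_action X \<theta>" "e \<in> idempotents" "\<theta> e x = Some y"
  shows "y = x"
proof -
  have "\<theta> (e * e) = \<theta> e \<circ>\<^sub>m \<theta> e" using assms(1) by (simp add: semigroup_action_def)
  hence "(\<theta> e \<circ>\<^sub>m \<theta> e) x = \<theta> e x" using assms(2) by (simp add: idempotents_def)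
  hence "\<theta> e y = Some y" using assms(3) by simp
  moreover have "inj_on (\<theta> e) (dom (\<theta> e))"
    using assms(1) by (simp add: semigroup_action_def partial_bijection_on_def)
  ultimately show ?thesis using assms(3) by (metis domI inj_on_def)
qed

lemma act_dom_mult:
  assumes "semigroup_action X \<theta>" "e \<in> idempotents" "f \<in> idempotents"
  shows "act_dom \<theta> (e * f) = act_dom \<theta> e \<inter> act_dom \<theta> f"
proof -
  have "\<theta> (e * f) x = Some x \<longleftrightarrow> \<theta> e x = Some x \<and> \<theta> f x = Some x" for x
  proof -
    have "\<theta> (e * f) = \<theta> e \<circ>\<^sub>m \<theta> f" using assms(1) by (simp add: semigroup_action_def)
    thus ?thesis
      using act_idempotent_fixes_range[OF assms(1,3), of x]
      by (auto simp: map_comp_def split: option.splits)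
  qed
  thus ?thesis by (auto simp: act_dom_def)
qed

lemma openin_act_dom: "semigroup_action X \<theta> \<Longrightarrow> e \<in> idempotents \<Longrightarrow> openin X (act_dom \<theta> e)"
  by (simp add: semigroup_action_def)

section \<open>Functions vanishing at infinity\<close>

lemma continuous_map_euclidean_iff_tendsto:
  "continuous_map Y euclidean f \<longleftrightarrow> (\<forall>x\<in>topspace Y. (f \<longlongrightarrow> f x) (atin Y x))"
  by (simp add: continuous_map_atin)

text \<open>The sets \<open>|g| \<ge> \<epsilon>\<close> are closed, so any enclosing compact set makes them compact.\<close>

lemma C0I:
  assumes "continuous_map Y euclidean g"
    and "\<And>\<epsilon>. \<epsilon> > 0 \<Longrightarrow> \<exists>K. compactin Y K \<and> {x \<in> topspace Y. \<epsilon> \<le> cmod (g x)} \<subseteq> K"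
    and "\<And>x. x \<notin> topspace Y \<Longrightarrow> g x = 0"
  shows "g \<in> C0 Y"
proof -
  have "compactin Y {x \<in> topspace Y. \<epsilon> \<le> cmod (g x)}" if "\<epsilon> > 0" for \<epsilon>
  proof -
    have "closedin Y {x \<in> topspace Y. g x \<in> {z. \<epsilon> \<le> cmod z}}"
      by (rule closedin_continuous_map_preimage[OF assms(1)])
         (auto simp: closed_Collect_le continuous_intros)
    thus ?thesis using assms(2)[OF that] by (auto intro: closed_compactin)
  qed
  thus ?thesis using assms by (auto simp: C0_def)
qed

lemma C0_continuous: "g \<in> C0 Y \<Longrightarrow> continuous_map Y euclidean g"
  and C0_compactin: "g \<in> C0 Y \<Longrightarrow> \<epsilon> > 0 \<Longrightarrow> compactin Y {x \<in> topspace Y. \<epsilon> \<le> cmod (g x)}"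
  and C0_outside: "g \<in> C0 Y \<Longrightarrow> x \<notin> topspace Y \<Longrightarrow> g x = 0"
  by (auto simp: C0_def)

lemma C0_bounded:
  assumes "g \<in> C0 Y"
  obtains M where "M > 0" "\<And>x. cmod (g x) \<le> M"
proof -
  let ?K = "{x \<in> topspace Y. 1 \<le> cmod (g x)}"
  have "compactin euclidean (g ` ?K)"
    using C0_compactin[OF assms] C0_continuous[OF assms] by (intro image_compactin) auto
  hence "bounded (g ` ?K)" by (simp add: compact_imp_bounded)
  then obtain M where "\<forall>z\<in>g ` ?K. norm z \<le> M" by (auto simp: bounded_iff)
  hence "cmod (g x) \<le> max 1 M" for x
    using C0_outside[OF assms, of x] by (cases "x \<in> ?K") auto
  thus ?thesis using that[of "max 1 M"] by auto
qed

lemma C0_zero: "(\<lambda>x. 0) \<in> C0 Y"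
  by (rule C0I) (auto intro!: exI[of _ "{}"])

lemma C0_add:
  assumes "g \<in> C0 Y" "h \<in> C0 Y"
  shows "(\<lambda>x. g x + h x) \<in> C0 Y"
proof (rule C0I)
  show "continuous_map Y euclidean (\<lambda>x. g x + h x)"
    using assms[THEN C0_continuous]
    by (auto simp: continuous_map_euclidean_iff_tendsto intro!: tendsto_add)
next
  fix \<epsilon> :: real assume "\<epsilon> > 0"
  let ?K = "{x \<in> topspace Y. \<epsilon>/2 \<le> cmod (g x)} \<union> {x \<in> topspace Y. \<epsilon>/2 \<le> cmod (h x)}"
  have "compactin Y ?K" using assms[THEN C0_compactin, of "\<epsilon>/2"] \<open>\<epsilon> > 0\<close> by (intro compactin_Un) auto
  moreover have "{x \<in> topspace Y. \<epsilon> \<le> cmod (g x + h x)} \<subseteq> ?K"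
  proof
    fix x assume "x \<in> {x \<in> topspace Y. \<epsilon> \<le> cmod (g x + h x)}"
    thus "x \<in> ?K" using norm_triangle_ineq[of "g x" "h x"] by auto
  qed
  ultimately show "\<exists>K. compactin Y K \<and> {x \<in> topspace Y. \<epsilon> \<le> cmod (g x + h x)} \<subseteq> K" by blast
qed (use assms[THEN C0_outside] in auto)

text \<open>A substitute for calculations in the unitization: the unitaries and the resolvent used below
  lie outside \<open>C0 Y\<close>, but are bounded and continuous.\<close>

lemma C0_mult_bounded:
  assumes "g \<in> C0 Y" "continuous_map Y euclidean b" "\<And>x. x \<in> topspace Y \<Longrightarrow> cmod (b x) \<le> M"
  shows "(\<lambda>x. g x * b x) \<in> C0 Y"
proof (rule C0I)
  show "continuous_map Y euclidean (\<lambda>x. g x * b x)"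
    using C0_continuous[OF assms(1)] assms(2)
    by (auto simp: continuous_map_euclidean_iff_tendsto intro!: tendsto_mult)
next
  fix \<epsilon> :: real assume "\<epsilon> > 0"
  define M' where "M' = max 1 M"
  have "{x \<in> topspace Y. \<epsilon> \<le> cmod (g x * b x)} \<subseteq> {x \<in> topspace Y. \<epsilon>/M' \<le> cmod (g x)}"
  proof clarify
    fix x assume x: "x \<in> topspace Y" "\<epsilon> \<le> cmod (g x * b x)"
    have "cmod (g x * b x) \<le> cmod (g x) * M'"
      using assms(3)[OF x(1)] by (auto simp: norm_mult M'_def intro!: mult_left_mono)
    thus "\<epsilon>/M' \<le> cmod (g x)" using x by (simp add: M'_def field_simps)
  qed
  thus "\<exists>K. compactin Y K \<and> {x \<in> topspace Y. \<epsilon> \<le> cmod (g x * b x)} \<subseteq> K"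
    using C0_compactin[OF assms(1), of "\<epsilon>/M'"] \<open>\<epsilon> > 0\<close> by (force simp: M'_def)
qed (use C0_outside[OF assms(1)] in auto)

lemma C0_scale: "g \<in> C0 Y \<Longrightarrow> (\<lambda>x. c * g x) \<in> C0 Y"
  using C0_mult_bounded[of g Y "\<lambda>x. c" "cmod c"] by (simp add: mult.commute)

lemma C0_diff: "g \<in> C0 Y \<Longrightarrow> h \<in> C0 Y \<Longrightarrow> (\<lambda>x. g x - h x) \<in> C0 Y"
  using C0_add[OF _ C0_scale, of g Y h "-1"] by simp

lemma C0_mult: "g \<in> C0 Y \<Longrightarrow> h \<in> C0 Y \<Longrightarrow> (\<lambda>x. g x * h x) \<in> C0 Y"
  by (rule C0_bounded[of h Y]) (auto intro: C0_mult_bounded C0_continuous)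

lemma C0_cnj: "g \<in> C0 Y \<Longrightarrow> (\<lambda>x. cnj (g x)) \<in> C0 Y"
  by (auto simp: C0_def continuous_map_euclidean_iff_tendsto intro!: tendsto_cnj)

lemma C0_sum: "(\<And>i. i \<in> I \<Longrightarrow> g i \<in> C0 Y) \<Longrightarrow> (\<lambda>x. \<Sum>i\<in>I. g i x) \<in> C0 Y"
  by (induction I rule: infinite_finite_induct) (auto intro: C0_zero C0_add)

text \<open>As both factors are bounded, \<open>|g h| \<ge> \<epsilon>\<close> bounds each of them below,
  which confines the point to a compact subset of \<open>U\<close> and to one of \<open>V\<close>. The product of elements
  of two summands of the algebra lands in the right summand for this reason.\<close>

lemma C0_mult_subtopology:
  assumes "Hausdorff_space X" "g \<in> C0 (subtopology X U)" "h \<in> C0 (subtopology X V)"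
  shows "(\<lambda>x. g x * h x) \<in> C0 (subtopology X (U \<inter> V))"
proof (rule C0I)
  have "continuous_map (subtopology X (U \<inter> V)) euclidean g"
    by (rule continuous_map_from_subtopology_mono[OF C0_continuous[OF assms(2)]]) auto
  moreover have "continuous_map (subtopology X (U \<inter> V)) euclidean h"
    by (rule continuous_map_from_subtopology_mono[OF C0_continuous[OF assms(3)]]) auto
  ultimately show "continuous_map (subtopology X (U \<inter> V)) euclidean (\<lambda>x. g x * h x)"
    unfolding continuous_map_euclidean_iff_tendsto by (blast intro: tendsto_mult)
next
  fix \<epsilon> :: real assume "\<epsilon> > 0"
  obtain M where M: "M > 0" "\<And>x. cmod (g x) \<le> M" using C0_bounded[OF assms(2)] by blast
  obtain N where N: "N > 0" "\<And>x. cmod (h x) \<le> N" using C0_bounded[OF assms(3)] by blast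
  let ?G = "{x \<in> topspace (subtopology X U). \<epsilon>/N \<le> cmod (g x)}"
  let ?H = "{x \<in> topspace (subtopology X V). \<epsilon>/M \<le> cmod (h x)}"
  have "compactin X ?G" "?G \<subseteq> U" "compactin X ?H" "?H \<subseteq> V"
    using C0_compactin[OF assms(2), of "\<epsilon>/N"] C0_compactin[OF assms(3), of "\<epsilon>/M"] M N \<open>\<epsilon> > 0\<close>
    by (auto simp: compactin_subtopology)
  hence "compactin (subtopology X (U \<inter> V)) (?G \<inter> ?H)"
    using assms(1)
    by (auto simp: compactin_subtopology intro!: compact_Int_closedin compactin_imp_closedin)
  moreover have "{x \<in> topspace (subtopology X (U \<inter> V)). \<epsilon> \<le> cmod (g x * h x)} \<subseteq> ?G \<inter> ?H"
  proof
    fix x assume x: "x \<in> {x \<in> topspace (subtopology X (U \<inter> V)). \<epsilon> \<le> cmod (g x * h x)}"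
    have "cmod (g x * h x) \<le> cmod (g x) * N" "cmod (g x * h x) \<le> M * cmod (h x)"
      using M N by (auto simp: norm_mult intro!: mult_left_mono mult_right_mono)
    thus "x \<in> ?G \<inter> ?H" using x M(1) N(1) by (auto simp: field_simps)
  qed
  ultimately show "\<exists>K. compactin (subtopology X (U \<inter> V)) K \<and>
      {x \<in> topspace (subtopology X (U \<inter> V)). \<epsilon> \<le> cmod (g x * h x)} \<subseteq> K" by blast
next
  fix x assume "x \<notin> topspace (subtopology X (U \<inter> V))"
  thus "g x * h x = 0" using C0_outside[OF assms(2), of x] C0_outside[OF assms(3), of x] by auto
qed

text \<open>Complete regularity provides the function, and local compactness a compact set outside of
  which it can be required to vanish.\<close>

lemma C0_bump:
  assumes "locally_compact_space Y" "Hausdorff_space Y" "openin Y U" "y \<in> U"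
  obtains g where "g \<in> C0 Y" "g y = 1" "\<And>x. x \<notin> U \<Longrightarrow> g x = 0"
proof -
  have yY: "y \<in> topspace Y" using assms(3,4) openin_subset by blast
  obtain V K where V: "openin Y V" "compactin Y K" "y \<in> V" "V \<subseteq> K"
    using assms(1) yY unfolding locally_compact_space_def by blast
  have "completely_regular_space Y"
    using assms(1,2) locally_compact_regular_imp_completely_regular_space
      locally_compact_Hausdorff_imp_regular_space by blast
  moreover have "closedin Y (topspace Y - U \<inter> V)" using assms(3) V(1) by blast
  ultimately obtain f :: "_ \<Rightarrow> real" where f: "continuous_map Y (top_of_set {0..1}) f" "f y = 0"
      "f ` (topspace Y - U \<inter> V) \<subseteq> {1}"
    using assms(4) V(3) yY unfolding completely_regular_space_def by (metis DiffD2 DiffI IntI)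
  have fc: "continuous_map Y euclidean f" using f(1) by (simp add: continuous_map_in_subtopology)
  define g where "g x = (if x \<in> topspace Y then complex_of_real (1 - f x) else 0)" for x
  have supp: "g x = 0" if "x \<notin> U \<inter> V" for x using that f(3) by (auto simp: g_def)
  have "g \<in> C0 Y"
  proof (rule C0I)
    have "continuous_map Y euclidean (\<lambda>x. complex_of_real (1 - f x))"
      using fc by (auto simp: continuous_map_euclidean_iff_tendsto intro!: tendsto_intros)
    thus "continuous_map Y euclidean g" by (rule continuous_map_eq) (simp add: g_def)
  next
    fix \<epsilon> :: real assume "\<epsilon> > 0"
    hence "{x \<in> topspace Y. \<epsilon> \<le> cmod (g x)} \<subseteq> K" using supp V(4) by fastforce
    thus "\<exists>K. compactin Y K \<and> {x \<in> topspace Y. \<epsilon> \<le> cmod (g x)} \<subseteq> K" using V(2) by blast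
  qed (simp add: g_def)
  thus ?thesis using that[of g] supp f(2) yY by (auto simp: g_def)
qed

section \<open>Multiplicative functionals on C0\<close>

lemma C0_separates_points:
  assumes "locally_compact_space Y" "Hausdorff_space Y"
    and "v \<in> topspace (Alexandroff_compactification Y)"
    and "w \<in> topspace (Alexandroff_compactification Y)"
    and "\<And>g. g \<in> C0 Y \<Longrightarrow> ext_infty g v = ext_infty g w"
  shows "v = w"
proof -
  have *: "w' = Some a"
    if "a \<in> topspace Y" "w' \<in> topspace (Alexandroff_compactification Y)"
      and eq: "\<And>g. g \<in> C0 Y \<Longrightarrow> ext_infty g (Some a) = ext_infty g w'" for a w'
  proof (rule ccontr)
    assume ne: "w' \<noteq> Some a"
    obtain U where U: "openin Y U" "a \<in> U" "w' \<notin> Some ` U"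
    proof (cases w')
      case None
      thus ?thesis using that[of "topspace Y"] \<open>a \<in> topspace Y\<close> by auto
    next
      case (Some b)
      then obtain U V where "openin Y U" "openin Y V" "a \<in> U" "b \<in> V" "disjnt U V"
        using assms(2)[unfolded Hausdorff_space_def, rule_format, of a b] ne \<open>a \<in> _\<close> \<open>w' \<in> _\<close>
        by auto
      thus ?thesis using that[of U] Some by (auto simp: disjnt_iff)
    qed
    obtain g where "g \<in> C0 Y" "g a = 1" "\<And>x. x \<notin> U \<Longrightarrow> g x = 0"
      using C0_bump[OF assms(1,2) U(1,2)] by blast
    moreover have "\<forall>b. w' = Some b \<longrightarrow> b \<notin> U" using U(3) by blast
    ultimately show False using eq[of g] by (auto simp: ext_infty_def split: option.splits)
  qed
  show ?thesis
  proof (cases v)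
    case (Some a)
    thus ?thesis using *[of a w] assms by auto
  next
    case None
    thus ?thesis using *[of _ v] assms by (cases w) auto
  qed
qed

text \<open>The multiplicative functionals on \<open>C0 Y\<close>, without any a priori bound. Were the
  kernel of \<open>\<omega>\<close> contained in no maximal ideal of a point, compactness would give
  \<open>F \<ge> 0\<close> in the kernel that is positive where a fixed \<open>u\<close> with \<open>\<omega> u = 1\<close> is not small. Then
  \<open>z = |u|\<^sup>2 - C F\<close> has \<open>\<omega> z = 1\<close> but \<open>z \<le> 1/4\<close>, so that the quasi-inverse
  \<open>q = z / (1 - z)\<close> exists in \<open>C0 Y\<close>; applying \<open>\<omega>\<close> to \<open>q - z q = z\<close> gives \<open>0 = 1\<close>.\<close>

lemma C0_multiplicative_functional_eq_eval:
  fixes Y :: "'x topology" and \<omega> :: "('x \<Rightarrow> complex) \<Rightarrow> complex"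
  assumes Y: "locally_compact_space Y" "Hausdorff_space Y"
    and add: "\<And>g h. g \<in> C0 Y \<Longrightarrow> h \<in> C0 Y \<Longrightarrow> \<omega> (\<lambda>x. g x + h x) = \<omega> g + \<omega> h"
    and scale: "\<And>c g. g \<in> C0 Y \<Longrightarrow> \<omega> (\<lambda>x. c * g x) = c * \<omega> g"
    and mult: "\<And>g h. g \<in> C0 Y \<Longrightarrow> h \<in> C0 Y \<Longrightarrow> \<omega> (\<lambda>x. g x * h x) = \<omega> g * \<omega> h"
    and star: "\<And>g. g \<in> C0 Y \<Longrightarrow> \<omega> (\<lambda>x. cnj (g x)) = cnj (\<omega> g)"
    and nonzero: "u0 \<in> C0 Y" "\<omega> u0 \<noteq> 0"
  shows "\<exists>y\<in>topspace Y. \<forall>g\<in>C0 Y. \<omega> g = g y"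
proof -
  have diff: "\<omega> (\<lambda>x. g x - h x) = \<omega> g - \<omega> h" if "g \<in> C0 Y" "h \<in> C0 Y" for g h
    using add[OF that(1) C0_scale[OF that(2), of "-1"]] scale[OF that(2), of "-1"] by simp
  have zero: "\<omega> (\<lambda>x. 0) = 0" using scale[OF C0_zero, of 0] by simp
  define u where "u x = inverse (\<omega> u0) * u0 x" for x
  have u: "u \<in> C0 Y" "\<omega> u = 1"
    using C0_scale[OF nonzero(1)] scale[OF nonzero(1)] nonzero(2) unfolding u_def by auto
  have "\<exists>y\<in>topspace Y. \<forall>f\<in>C0 Y. \<omega> f = 0 \<longrightarrow> f y = 0"
  proof (rule ccontr)
    assume "\<not> ?thesis"
    then obtain f where f: "\<And>y. y \<in> topspace Y \<Longrightarrow> f y \<in> C0 Y \<and> \<omega> (f y) = 0 \<and> f y y \<noteq> 0"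
      by metis
    define K where "K = {x \<in> topspace Y. 1/2 \<le> cmod (u x)}"
    have K: "compactin Y K" using C0_compactin[OF u(1), of "1/2"] by (simp add: K_def)
    define N where "N y = {x \<in> topspace Y. f y x \<in> - {0}}" for y
    have "openin Y (N y)" if "y \<in> topspace Y" for y
      unfolding N_def
      by (rule openin_continuous_map_preimage[OF C0_continuous]) (use f that in auto)
    moreover have "K \<subseteq> \<Union>(N ` K)" using f by (auto simp: K_def N_def)
    ultimately have "\<exists>\<F>. finite \<F> \<and> \<F> \<subseteq> N ` K \<and> K \<subseteq> \<Union>\<F>"
      using K by (intro compactinD) (auto simp: K_def)
    then obtain J where J: "finite J" "J \<subseteq> K" "K \<subseteq> \<Union>(N ` J)"
      by (metis finite_subset_image)
    define F where "F x = (\<Sum>y\<in>J. f y x * cnj (f y x))" for x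
    define R where "R x = (\<Sum>y\<in>J. (cmod (f y x))\<^sup>2)" for x
    have FR: "F x = complex_of_real (R x)" for x
      unfolding F_def R_def of_real_sum complex_norm_square ..
    have fJ: "f y \<in> C0 Y" "\<omega> (f y) = 0" if "y \<in> J" for y
      using that J(2) f by (auto simp: K_def)
    have F0: "F \<in> C0 Y" unfolding F_def by (intro C0_sum C0_mult C0_cnj fJ)
    have "\<omega> (\<lambda>x. \<Sum>y\<in>J. f y x * cnj (f y x)) = 0"
      using J(1) fJ
    proof (induction J rule: finite_induct)
      case (insert i I)
      have "\<omega> (\<lambda>x. f i x * cnj (f i x) + (\<Sum>y\<in>I. f y x * cnj (f y x))) = 0"
        using insert by (subst add) (auto simp: mult C0_cnj intro!: C0_sum C0_mult)
      thus ?case using insert by simp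
    qed (use zero in simp)
    hence \<omega>F: "\<omega> F = 0" by (simp add: F_def[abs_def])
    have R_pos: "R x > 0" if xK: "x \<in> K" for x
    proof -
      obtain y where "y \<in> J" "f y x \<noteq> 0" using xK J(3) by (auto simp: N_def)
      thus ?thesis unfolding R_def using J(1) by (intro sum_pos2[of _ y]) auto
    qed
    have R0: "R x \<ge> 0" for x by (simp add: R_def sum_nonneg)
    have "compactin euclidean (F ` K)" by (rule image_compactin[OF K C0_continuous[OF F0]])
    hence "open (- F ` K)" by (simp add: compact_imp_closed open_Compl)
    moreover have "0 \<in> - F ` K" using R_pos by (force simp: FR)
    ultimately obtain \<delta> where \<delta>: "\<delta> > 0" "ball 0 \<delta> \<subseteq> - F ` K" by (meson openE)
    have R_\<delta>: "R x \<ge> \<delta>" if "x \<in> K" for x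
    proof (rule ccontr)
      assume "\<not> R x \<ge> \<delta>"
      hence "F x \<in> ball 0 \<delta>" using R0[of x] by (simp add: FR)
      thus False using \<delta>(2) that by blast
    qed
    obtain M where M: "M > 0" "\<And>x. cmod (u x) \<le> M" using C0_bounded[OF u(1)] by blast
    define C where "C = M\<^sup>2 / \<delta>"
    \<comment> \<open>On \<open>K\<close> the constant \<open>C\<close> makes \<open>z \<le> 0\<close>; outside \<open>K\<close>, \<open>z \<le> |u|\<^sup>2 < 1/4\<close>.\<close>
    define z where "z x = u x * cnj (u x) - complex_of_real C * F x" for x
    define r where "r x = (cmod (u x))\<^sup>2 - C * R x" for x
    have zr: "z x = complex_of_real (r x)" for x
      by (simp only: z_def r_def FR complex_norm_square of_real_diff of_real_mult)
    have z0: "z \<in> C0 Y" unfolding z_def by (intro C0_diff C0_mult C0_cnj C0_scale u F0)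
    have \<omega>z: "\<omega> z = 1"
    proof -
      have "\<omega> z = \<omega> (\<lambda>x. u x * cnj (u x)) - \<omega> (\<lambda>x. complex_of_real C * F x)"
        unfolding z_def by (intro diff C0_mult C0_cnj C0_scale u F0)
      thus ?thesis by (simp add: mult star scale u C0_cnj F0 \<omega>F)
    qed
    have r: "r x \<le> 1/4" if "x \<in> topspace Y" for x
    proof (cases "x \<in> K")
      case True
      have "(cmod (u x))\<^sup>2 \<le> M\<^sup>2" using M by (intro power_mono) auto
      also have "M\<^sup>2 = C * \<delta>" using \<delta>(1) by (simp add: C_def)
      also have "\<dots> \<le> C * R x" using R_\<delta>[OF True] \<delta>(1) by (intro mult_left_mono) (auto simp: C_def)
      finally show ?thesis by (simp add: r_def)
    next
      case False
      hence "(cmod (u x))\<^sup>2 \<le> (1/2)\<^sup>2" using that by (intro power_mono) (auto simp: K_def)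
      moreover have "C * R x \<ge> 0" using R0 \<delta>(1) by (simp add: C_def)
      ultimately show ?thesis by (simp add: r_def power2_eq_square)
    qed
    define b where "b x = inverse (1 - z x)" for x
    define q where "q x = z x * b x" for x
    have z_ne: "1 - z x \<noteq> 0" if "x \<in> topspace Y" for x
    proof -
      have "1 - z x = complex_of_real (1 - r x)" by (simp add: zr)
      thus ?thesis using r[OF that] by (simp only: of_real_eq_0_iff)
    qed
    have "q \<in> C0 Y"
      unfolding q_def
    proof (rule C0_mult_bounded[OF z0])
      show "continuous_map Y euclidean b"
        using C0_continuous[OF z0] z_ne unfolding b_def[abs_def]
        by (auto simp: continuous_map_euclidean_iff_tendsto intro!: tendsto_intros)
      show "cmod (b x) \<le> 4/3" if "x \<in> topspace Y" for x
      proof -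
        have "cmod (1 - z x) = \<bar>1 - r x\<bar>" unfolding zr by (metis norm_of_real of_real_1 of_real_diff)
        hence "cmod (1 - z x) \<ge> 3/4" using r[OF that] by simp
        hence "inverse (cmod (1 - z x)) \<le> inverse (3/4)" by (intro le_imp_inverse_le) auto
        thus ?thesis by (simp add: b_def norm_inverse)
      qed
    qed
    moreover have "(\<lambda>x. q x - z x * q x) = z"
    proof
      fix x
      show "q x - z x * q x = z x"
      proof (cases "x \<in> topspace Y")
        case True
        have "q x - z x * q x = z x * (b x * (1 - z x))" by (simp add: q_def algebra_simps)
        thus ?thesis using z_ne[OF True] by (simp add: b_def)
      qed (simp add: q_def C0_outside[OF z0])
    qed
    ultimately have "\<omega> z = \<omega> q - \<omega> z * \<omega> q"
      using diff[OF _ C0_mult[OF z0], of q q] mult[OF z0] by simp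
    thus False by (simp add: \<omega>z)
  qed
  then obtain y where y: "y \<in> topspace Y" "\<And>f. f \<in> C0 Y \<Longrightarrow> \<omega> f = 0 \<Longrightarrow> f y = 0" by blast
  \<comment> \<open>Functionals with nested kernels are proportional; multiplicativity fixes the factor.\<close>
  have eq: "g y = \<omega> g * u y" if "g \<in> C0 Y" for g
    using y(2)[OF C0_diff[OF that C0_scale[OF u(1), of "\<omega> g"]]]
    by (simp add: diff that C0_scale u scale)
  obtain b where "b \<in> C0 Y" "b y = 1" using C0_bump[OF Y openin_topspace y(1)] by metis
  hence "u y \<noteq> 0" using eq[of b] by auto
  moreover have "u y * u y = u y" using eq[OF C0_mult[OF u(1) u(1)]] mult[OF u(1) u(1)] u(2) by simp
  ultimately have "u y = 1" by simp
  thus ?thesis using eq y(1) by auto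
qed

corollary C0_multiplicative_functional_point:
  fixes Y :: "'x topology" and \<omega> :: "('x \<Rightarrow> complex) \<Rightarrow> complex"
  assumes Y: "locally_compact_space Y" "Hausdorff_space Y"
    and "\<And>g h. g \<in> C0 Y \<Longrightarrow> h \<in> C0 Y \<Longrightarrow> \<omega> (\<lambda>x. g x + h x) = \<omega> g + \<omega> h"
    and "\<And>c g. g \<in> C0 Y \<Longrightarrow> \<omega> (\<lambda>x. c * g x) = c * \<omega> g"
    and "\<And>g h. g \<in> C0 Y \<Longrightarrow> h \<in> C0 Y \<Longrightarrow> \<omega> (\<lambda>x. g x * h x) = \<omega> g * \<omega> h"
    and "\<And>g. g \<in> C0 Y \<Longrightarrow> \<omega> (\<lambda>x. cnj (g x)) = cnj (\<omega> g)"
  shows "\<exists>v\<in>topspace (Alexandroff_compactification Y). \<forall>g\<in>C0 Y. ext_infty g v = \<omega> g"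
proof (cases "\<exists>u\<in>C0 Y. \<omega> u \<noteq> 0")
  case True
  then obtain u where "u \<in> C0 Y" "\<omega> u \<noteq> 0" by blast
  then obtain y where "y \<in> topspace Y" "\<forall>g\<in>C0 Y. \<omega> g = g y"
    using C0_multiplicative_functional_eq_eval[where \<omega> = \<omega>, OF assms] by blast
  thus ?thesis by (intro bexI[of _ "Some y"]) (auto simp: ext_infty_def)
next
  case False
  thus ?thesis by (intro bexI[of _ None]) (auto simp: ext_infty_def)
qed

section \<open>The weak topology of the one-point compactification\<close>

lemma continuous_map_ext_infty:
  assumes "g \<in> C0 Y"
  shows "continuous_map (Alexandroff_compactification Y) euclidean (ext_infty g)"
  unfolding continuous_map_def
proof safe
  let ?Y = "Alexandroff_compactification Y"
  fix W :: "complex set" assume "openin euclidean W"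
  hence W: "open W" by simp
  have o: "openin Y {x \<in> topspace Y. g x \<in> W}"
    using C0_continuous[OF assms] W by (intro openin_continuous_map_preimage) auto
  show "openin ?Y {v \<in> topspace ?Y. ext_infty g v \<in> W}"
  proof (cases "0 \<in> W")
    case False
    hence "{v \<in> topspace ?Y. ext_infty g v \<in> W} = Some ` {x \<in> topspace Y. g x \<in> W}"
      by (auto simp: ext_infty_def)
    thus ?thesis using o by simp
  next
    case True
    then obtain \<epsilon> where \<epsilon>: "\<epsilon> > 0" "ball 0 \<epsilon> \<subseteq> W" using W by (meson openE)
    define C where "C = topspace Y - {x \<in> topspace Y. g x \<in> W}"
    have "closedin Y C" using o by (auto simp: C_def)
    moreover have "C \<subseteq> {x \<in> topspace Y. \<epsilon> \<le> cmod (g x)}"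
      using \<epsilon>(2) by (force simp: C_def)
    ultimately have "compactin Y C" using C0_compactin[OF assms \<epsilon>(1)] by (blast intro: closed_compactin)
    moreover have "{v \<in> topspace ?Y. ext_infty g v \<in> W} = insert None (Some ` (topspace Y - C))"
      using True by (auto simp: ext_infty_def C_def)
    ultimately show ?thesis
      using \<open>closedin Y C\<close> unfolding openin_Alexandroff_compactification by blast
  qed
qed auto

text \<open>The one-point compactification carries the weak topology of the extended functions:
  together they map it injectively into a Hausdorff product, and it is compact.\<close>

lemma continuous_map_into_Alexandroff:
  assumes Y: "locally_compact_space Y" "Hausdorff_space Y"
    and F: "F \<in> topspace Z \<rightarrow> topspace (Alexandroff_compactification Y)"
    and cont: "\<And>g. g \<in> C0 Y \<Longrightarrow> continuous_map Z euclidean (\<lambda>z. ext_infty g (F z))"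
  shows "continuous_map Z (Alexandroff_compactification Y) F"
proof -
  let ?Y = "Alexandroff_compactification Y"
  let ?P = "product_topology (\<lambda>_::_ \<Rightarrow> complex. euclidean :: complex topology) (C0 Y)"
  define \<Phi> where "\<Phi> v = (\<lambda>g\<in>C0 Y. ext_infty g v)" for v
  have "continuous_map ?Y ?P \<Phi>"
    unfolding continuous_map_componentwise \<Phi>_def
    by (auto simp: continuous_map_ext_infty)
  moreover have "inj_on \<Phi> (topspace ?Y)"
  proof (rule inj_onI)
    fix v w assume *: "v \<in> topspace ?Y" "w \<in> topspace ?Y" "\<Phi> v = \<Phi> w"
    show "v = w"
    proof (rule C0_separates_points[OF Y *(1,2)])
      fix g assume "g \<in> C0 Y"
      thus "ext_infty g v = ext_infty g w" using fun_cong[OF *(3), of g] by (simp add: \<Phi>_def)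
    qed
  qed
  moreover have "Hausdorff_space ?P" by (auto simp: Hausdorff_space_product_topology)
  ultimately have "embedding_map ?Y ?P \<Phi>" by (intro continuous_imp_embedding_map) auto
  then obtain \<Psi> where \<Psi>: "homeomorphic_maps ?Y (subtopology ?P (\<Phi> ` topspace ?Y)) \<Phi> \<Psi>"
    unfolding embedding_map_def homeomorphic_map_maps by blast
  have "continuous_map Z ?P (\<lambda>z. \<Phi> (F z))"
    unfolding continuous_map_componentwise \<Phi>_def
    using cont by (auto)
  hence "continuous_map Z (subtopology ?P (\<Phi> ` topspace ?Y)) (\<lambda>z. \<Phi> (F z))"
    using F by (auto simp: continuous_map_in_subtopology Pi_iff)
  hence "continuous_map Z ?Y (\<Psi> \<circ> (\<lambda>z. \<Phi> (F z)))"
    using \<Psi> unfolding homeomorphic_maps_def by (blast intro: continuous_map_compose)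
  thus ?thesis
    by (rule continuous_map_eq) (use \<Psi> F in \<open>auto simp: homeomorphic_maps_def Pi_iff\<close>)
qed

section \<open>Enveloping C*-algebras\<close>

text \<open>The addition of \<open>A\<close> is that of the ambient type, so that linear calculations in the carrier are
  ordinary group calculations. The axioms are the part of the algebra structure that the
  completion has to inherit; the last one says that the universal seminorm is finite, so that
  the supremum defining it is the true one.\<close>

locale enveloped_star_algebra =
  fixes A :: "('a::ab_group_add, 'm) star_algebra_scheme"
  assumes add_eq: "sa_add A a b = a + b"
    and zero_closed: "0 \<in> sa_carrier A"
    and add_closed: "a \<in> sa_carrier A \<Longrightarrow> b \<in> sa_carrier A \<Longrightarrow> a + b \<in> sa_carrier A"
    and scale_closed: "a \<in> sa_carrier A \<Longrightarrow> sa_scale A c a \<in> sa_carrier A"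
    and mult_closed: "a \<in> sa_carrier A \<Longrightarrow> b \<in> sa_carrier A \<Longrightarrow> sa_mult A a b \<in> sa_carrier A"
    and star_closed: "a \<in> sa_carrier A \<Longrightarrow> sa_star A a \<in> sa_carrier A"
    and scale_minus_one: "a \<in> sa_carrier A \<Longrightarrow> sa_scale A (-1) a = - a"
    and scale_add: "a \<in> sa_carrier A \<Longrightarrow> b \<in> sa_carrier A \<Longrightarrow>
      sa_scale A c (a + b) = sa_scale A c a + sa_scale A c b"
    and mult_add_left: "a \<in> sa_carrier A \<Longrightarrow> b \<in> sa_carrier A \<Longrightarrow> d \<in> sa_carrier A \<Longrightarrow>
      sa_mult A (a + b) d = sa_mult A a d + sa_mult A b d"
    and mult_add_right: "a \<in> sa_carrier A \<Longrightarrow> b \<in> sa_carrier A \<Longrightarrow> d \<in> sa_carrier A \<Longrightarrow>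
      sa_mult A d (a + b) = sa_mult A d a + sa_mult A d b"
    and star_add: "a \<in> sa_carrier A \<Longrightarrow> b \<in> sa_carrier A \<Longrightarrow>
      sa_star A (a + b) = sa_star A a + sa_star A b"
    and star_star: "a \<in> sa_carrier A \<Longrightarrow> sa_star A (sa_star A a) = a"
    and seminorms_bounded: "a \<in> sa_carrier A \<Longrightarrow> \<exists>M. \<forall>p. cstar_seminorm A p \<longrightarrow> p a \<le> M"
begin

abbreviation N :: "'a \<Rightarrow> real" where "N \<equiv> universal_seminorm A"
abbreviation mult :: "'a \<Rightarrow> 'a \<Rightarrow> 'a" (infixl "\<odot>" 70) where "mult \<equiv> sa_mult A"

lemma uminus_closed: "a \<in> sa_carrier A \<Longrightarrow> - a \<in> sa_carrier A"
  using scale_closed[of a "-1"] by (simp add: scale_minus_one)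

lemma diff_closed: "a \<in> sa_carrier A \<Longrightarrow> b \<in> sa_carrier A \<Longrightarrow> a - b \<in> sa_carrier A"
  using add_closed[of a "-b"] uminus_closed[of b] by simp

lemmas closed = zero_closed add_closed scale_closed mult_closed star_closed uminus_closed diff_closed

lemma mult_diff_left: "a \<in> sa_carrier A \<Longrightarrow> b \<in> sa_carrier A \<Longrightarrow> d \<in> sa_carrier A \<Longrightarrow>
    (a - b) \<odot> d = a \<odot> d - b \<odot> d"
  using mult_add_left[of "a - b" b d] by (simp add: diff_closed)

lemma mult_diff_right: "a \<in> sa_carrier A \<Longrightarrow> b \<in> sa_carrier A \<Longrightarrow> d \<in> sa_carrier A \<Longrightarrow>
    d \<odot> (a - b) = d \<odot> a - d \<odot> b"
  using mult_add_right[of "a - b" b d] by (simp add: diff_closed)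

lemma scale_diff: "a \<in> sa_carrier A \<Longrightarrow> b \<in> sa_carrier A \<Longrightarrow>
    sa_scale A c (a - b) = sa_scale A c a - sa_scale A c b"
  using scale_add[of "a - b" b c] by (simp add: diff_closed)

lemma star_diff: "a \<in> sa_carrier A \<Longrightarrow> b \<in> sa_carrier A \<Longrightarrow>
    sa_star A (a - b) = sa_star A a - sa_star A b"
  using star_add[of "a - b" b] by (simp add: diff_closed)

lemma cstar_seminorm_zero: "cstar_seminorm A (\<lambda>_. 0)"
  by (simp add: cstar_seminorm_def)

lemma seminorm_le_N: "cstar_seminorm A p \<Longrightarrow> a \<in> sa_carrier A \<Longrightarrow> p a \<le> N a"
  unfolding universal_seminorm_def using seminorms_bounded[of a]
  by (intro cSUP_upper) (auto simp: bdd_above_def)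

lemma N_least: "(\<And>p. cstar_seminorm A p \<Longrightarrow> p a \<le> r) \<Longrightarrow> N a \<le> r"
  unfolding universal_seminorm_def using cstar_seminorm_zero by (intro cSUP_least) auto

lemma N_nonneg: "a \<in> sa_carrier A \<Longrightarrow> N a \<ge> 0"
  using seminorm_le_N[OF cstar_seminorm_zero] by simp

lemma N_add: "a \<in> sa_carrier A \<Longrightarrow> b \<in> sa_carrier A \<Longrightarrow> N (a + b) \<le> N a + N b"
proof (rule N_least)
  fix p assume "a \<in> sa_carrier A" "b \<in> sa_carrier A" "cstar_seminorm A p"
  thus "p (a + b) \<le> N a + N b"
    using seminorm_le_N[of p a] seminorm_le_N[of p b]
    by (force simp: cstar_seminorm_def add_eq)
qed

lemma N_scale: "a \<in> sa_carrier A \<Longrightarrow> N (sa_scale A c a) \<le> cmod c * N a"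
proof (rule N_least)
  fix p assume "a \<in> sa_carrier A" "cstar_seminorm A p"
  thus "p (sa_scale A c a) \<le> cmod c * N a"
    using seminorm_le_N[of p a] by (simp add: cstar_seminorm_def mult_left_mono)
qed

lemma N_mult: "a \<in> sa_carrier A \<Longrightarrow> b \<in> sa_carrier A \<Longrightarrow> N (a \<odot> b) \<le> N a * N b"
proof (rule N_least)
  fix p assume *: "a \<in> sa_carrier A" "b \<in> sa_carrier A" "cstar_seminorm A p"
  hence "p (a \<odot> b) \<le> p a * p b" by (simp add: cstar_seminorm_def)
  also have "\<dots> \<le> N a * N b"
    using * by (intro mult_mono seminorm_le_N N_nonneg) (auto simp: cstar_seminorm_def)
  finally show "p (a \<odot> b) \<le> N a * N b" .
qed

text \<open>For every C*-seminorm, \<open>p(a\<^sup>*)\<^sup>2 = p(a a\<^sup>*) \<le> p(a) p(a\<^sup>*)\<close>.\<close>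

lemma N_star: "a \<in> sa_carrier A \<Longrightarrow> N (sa_star A a) \<le> N a"
proof (rule N_least)
  fix p assume a: "a \<in> sa_carrier A" and p: "cstar_seminorm A p"
  let ?b = "sa_star A a"
  have b: "?b \<in> sa_carrier A" using a by (rule star_closed)
  have "(p ?b)\<^sup>2 = p (sa_star A ?b \<odot> ?b)" using p b by (simp add: cstar_seminorm_def)
  also have "\<dots> \<le> p a * p ?b" using p a b by (simp add: cstar_seminorm_def star_star)
  finally have "p ?b * p ?b \<le> p a * p ?b" by (simp add: power2_eq_square)
  moreover have "p ?b \<ge> 0" "p a \<ge> 0" using p a b by (auto simp: cstar_seminorm_def)
  ultimately have "p ?b \<le> p a" by (cases "p ?b = 0") (auto simp: mult_le_cancel_right)
  thus "p ?b \<le> N a" using seminorm_le_N[OF p a] by simp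
qed

lemma N_uminus: "a \<in> sa_carrier A \<Longrightarrow> N (- a) = N a"
  using N_scale[of a "-1"] N_scale[of "- a" "-1"]
  by (simp add: scale_minus_one uminus_closed)

lemma N_zero: "N 0 = 0"
  using N_nonneg[OF zero_closed] N_scale[OF zero_closed, of 0]
    scale_add[OF zero_closed zero_closed, of 0] by simp

lemma N_diff: "a \<in> sa_carrier A \<Longrightarrow> b \<in> sa_carrier A \<Longrightarrow> N (a - b) \<le> N a + N b"
  using N_add[of a "-b"] by (simp add: uminus_closed N_uminus)

lemma N_diff_commute: "a \<in> sa_carrier A \<Longrightarrow> b \<in> sa_carrier A \<Longrightarrow> N (a - b) = N (b - a)"
  using N_uminus[of "a - b"] by (simp add: diff_closed)

lemma sa_dist_eq: "b \<in> sa_carrier A \<Longrightarrow> sa_dist A a b = N (a - b)"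
  by (simp add: sa_dist_def add_eq scale_minus_one)

lemma Cauchy_carrier: "u \<in> sa_Cauchy A \<Longrightarrow> u n \<in> sa_carrier A"
  by (auto simp: sa_Cauchy_def)

lemma Cauchy_iff:
  "u \<in> sa_Cauchy A \<longleftrightarrow> (\<forall>n. u n \<in> sa_carrier A) \<and>
     (\<forall>\<epsilon>>0. \<exists>M. \<forall>m\<ge>M. \<forall>n\<ge>M. N (u m - u n) < \<epsilon>)"
  by (auto simp: sa_Cauchy_def sa_dist_eq image_subset_iff)

lemma CauchyD:
  assumes "u \<in> sa_Cauchy A" "\<epsilon> > 0"
  obtains M where "\<And>m n. m \<ge> M \<Longrightarrow> n \<ge> M \<Longrightarrow> N (u m - u n) < \<epsilon>"
  using assms unfolding Cauchy_iff by blast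

lemma Cauchy_const: "a \<in> sa_carrier A \<Longrightarrow> (\<lambda>_. a) \<in> sa_Cauchy A"
  by (auto simp: Cauchy_iff N_zero)

lemma Cauchy_bounded:
  assumes u: "u \<in> sa_Cauchy A"
  obtains K where "K > 0" "\<And>n. N (u n) \<le> K"
proof -
  obtain M where M: "\<And>m n. m \<ge> M \<Longrightarrow> n \<ge> M \<Longrightarrow> N (u m - u n) < 1" using CauchyD[OF u, of 1] by auto
  define K where "K = Max ((\<lambda>n. N (u n)) ` {..M}) + 1"
  have K: "N (u n) \<le> K - 1" if "n \<le> M" for n using that by (auto simp: K_def)
  have "N (u n) \<le> K" for n
  proof (cases "n \<le> M")
    case False
    have "N (u n) = N ((u n - u M) + u M)" by simp
    also have "\<dots> \<le> N (u n - u M) + N (u M)" using u by (intro N_add closed Cauchy_carrier) auto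
    also have "\<dots> \<le> K" using M[of n M] K[of M] False by simp
    finally show ?thesis .
  qed (use K in fastforce)
  moreover have "K > 0" using K[of 0] N_nonneg[OF Cauchy_carrier[OF u], of 0] by simp
  ultimately show ?thesis using that by blast
qed

text \<open>Common pattern for the operations of the completion, all of which are Lipschitz on bounded sets.\<close>

lemma CauchyI_dominated:
  assumes "\<And>n. w n \<in> sa_carrier A" "u \<in> sa_Cauchy A" "v \<in> sa_Cauchy A" "K \<ge> 0" "L \<ge> 0"
    and le: "\<And>m n. N (w m - w n) \<le> K * N (u m - u n) + L * N (v m - v n)"
  shows "w \<in> sa_Cauchy A"
  unfolding Cauchy_iff
proof safe
  fix \<epsilon> :: real assume "\<epsilon> > 0"
  define \<delta> where "\<delta> = \<epsilon> / (K + L + 1)"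
  have \<delta>: "\<delta> > 0" using \<open>\<epsilon> > 0\<close> assms by (simp add: \<delta>_def)
  obtain M1 where M1: "\<And>m n. m \<ge> M1 \<Longrightarrow> n \<ge> M1 \<Longrightarrow> N (u m - u n) < \<delta>" using CauchyD assms \<delta> by metis
  obtain M2 where M2: "\<And>m n. m \<ge> M2 \<Longrightarrow> n \<ge> M2 \<Longrightarrow> N (v m - v n) < \<delta>" using CauchyD assms \<delta> by metis
  show "\<exists>M. \<forall>m\<ge>M. \<forall>n\<ge>M. N (w m - w n) < \<epsilon>"
  proof (intro exI[of _ "max M1 M2"] allI impI)
    fix m n assume "max M1 M2 \<le> m" "max M1 M2 \<le> n"
    hence "K * N (u m - u n) \<le> K * \<delta>" "L * N (v m - v n) \<le> L * \<delta>"
      using M1[of m n] M2[of m n] assms by (auto intro!: mult_left_mono)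
    hence "N (w m - w n) \<le> K * \<delta> + L * \<delta>" using le[of m n] by simp
    also have "\<dots> < (K + L + 1) * \<delta>" using \<delta> by (simp add: algebra_simps)
    also have "\<dots> = \<epsilon>" using assms by (simp add: \<delta>_def)
    finally show "N (w m - w n) < \<epsilon>" .
  qed
qed (use assms in blast)

lemma mult_diff_mult:
  assumes "a \<in> sa_carrier A" "b \<in> sa_carrier A" "a' \<in> sa_carrier A" "b' \<in> sa_carrier A"
  shows "N (a \<odot> b - a' \<odot> b') \<le> N b * N (a - a') + N a' * N (b - b')"
proof -
  have "a \<odot> b - a' \<odot> b' = (a - a') \<odot> b + a' \<odot> (b - b')"
    using assms by (simp add: mult_diff_left mult_diff_right)
  also have "N \<dots> \<le> N ((a - a') \<odot> b) + N (a' \<odot> (b - b'))"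
    using assms by (intro N_add closed)
  also have "\<dots> \<le> N (a - a') * N b + N a' * N (b - b')"
    using assms by (intro add_mono N_mult closed)
  finally show ?thesis by (simp add: mult.commute)
qed

lemma Cauchy_add:
  assumes "u \<in> sa_Cauchy A" "v \<in> sa_Cauchy A"
  shows "(\<lambda>n. u n + v n) \<in> sa_Cauchy A"
proof (rule CauchyI_dominated[OF _ assms, of _ 1 1])
  fix m n
  have "N ((u m - u n) + (v m - v n)) \<le> N (u m - u n) + N (v m - v n)"
    using assms by (intro N_add closed Cauchy_carrier)
  thus "N (u m + v m - (u n + v n)) \<le> 1 * N (u m - u n) + 1 * N (v m - v n)"
    by (simp add: algebra_simps)
qed (use assms in \<open>auto intro: closed Cauchy_carrier\<close>)

lemma Cauchy_scale:
  assumes "u \<in> sa_Cauchy A"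
  shows "(\<lambda>n. sa_scale A c (u n)) \<in> sa_Cauchy A"
proof (rule CauchyI_dominated[OF _ assms assms, of _ "cmod c" 0])
  fix m n
  show "N (sa_scale A c (u m) - sa_scale A c (u n)) \<le> cmod c * N (u m - u n) + 0 * N (u m - u n)"
    using N_scale[of "u m - u n" c] Cauchy_carrier[OF assms]
    by (simp add: scale_diff diff_closed)
qed (use assms in \<open>auto intro: closed Cauchy_carrier\<close>)

lemma Cauchy_star:
  assumes "u \<in> sa_Cauchy A"
  shows "(\<lambda>n. sa_star A (u n)) \<in> sa_Cauchy A"
proof (rule CauchyI_dominated[OF _ assms assms, of _ 1 0])
  fix m n
  show "N (sa_star A (u m) - sa_star A (u n)) \<le> 1 * N (u m - u n) + 0 * N (u m - u n)"
    using N_star[of "u m - u n"] Cauchy_carrier[OF assms]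
    by (simp add: star_diff diff_closed)
qed (use assms in \<open>auto intro: closed Cauchy_carrier\<close>)

lemma Cauchy_mult:
  assumes "u \<in> sa_Cauchy A" "v \<in> sa_Cauchy A"
  shows "(\<lambda>n. u n \<odot> v n) \<in> sa_Cauchy A"
proof -
  obtain K where K: "K > 0" "\<And>n. N (u n) \<le> K" using Cauchy_bounded assms(1) by blast
  obtain L where L: "L > 0" "\<And>n. N (v n) \<le> L" using Cauchy_bounded assms(2) by blast
  show ?thesis
  proof (rule CauchyI_dominated[OF _ assms, of _ L K])
    fix m n
    have "N (u m \<odot> v m - u n \<odot> v n) \<le> N (v m) * N (u m - u n) + N (u n) * N (v m - v n)"
      using assms by (intro mult_diff_mult Cauchy_carrier)
    also have "\<dots> \<le> L * N (u m - u n) + K * N (v m - v n)"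
      using assms K L by (intro add_mono mult_right_mono N_nonneg closed Cauchy_carrier)
    finally show "N (u m \<odot> v m - u n \<odot> v n) \<le> L * N (u m - u n) + K * N (v m - v n)" .
  qed (use assms K L in \<open>auto intro: closed Cauchy_carrier\<close>)
qed

lemma Cauchy_shift: "u \<in> sa_Cauchy A \<Longrightarrow> (\<lambda>n. u (n + k)) \<in> sa_Cauchy A"
  by (simp add: Cauchy_iff) (meson trans_le_add1)

definition cls :: "(nat \<Rightarrow> 'a) \<Rightarrow> (nat \<Rightarrow> 'a) set" where "cls u = sa_rel A `` {u}"

abbreviation B :: "(nat \<Rightarrow> 'a) set cstar_algebra" where "B \<equiv> enveloping_cstar A"

lemma rel_iff:
  "(u, v) \<in> sa_rel A \<longleftrightarrow> u \<in> sa_Cauchy A \<and> v \<in> sa_Cauchy A \<and> (\<lambda>n. N (u n - v n)) \<longlonglongrightarrow> 0"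
  by (auto simp: sa_rel_def sa_dist_eq Cauchy_carrier)

lemma tendsto_0_dominated:
  assumes "\<And>n. a n \<in> sa_carrier A" "\<And>n. N (a n) \<le> f n" "f \<longlonglongrightarrow> 0"
  shows "(\<lambda>n. N (a n)) \<longlonglongrightarrow> 0"
  by (rule tendsto_sandwich[OF _ _ tendsto_const assms(3)]) (use assms N_nonneg in auto)

lemma equiv_rel: "equiv (sa_Cauchy A) (sa_rel A)"
proof (rule equivI)
  show "sym (sa_rel A)"
  proof (rule symI)
    fix u v assume "(u, v) \<in> sa_rel A"
    moreover from this have "N (u n - v n) = N (v n - u n)" for n
      by (intro N_diff_commute) (auto simp: rel_iff Cauchy_carrier)
    ultimately show "(v, u) \<in> sa_rel A" by (simp add: rel_iff)
  qed
  show "trans (sa_rel A)"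
  proof (rule transI)
    fix u v w assume *: "(u, v) \<in> sa_rel A" "(v, w) \<in> sa_rel A"
    hence c: "u n \<in> sa_carrier A" "v n \<in> sa_carrier A" "w n \<in> sa_carrier A" for n
      by (auto simp: rel_iff Cauchy_carrier)
    have "N (u n - w n) \<le> N (u n - v n) + N (v n - w n)" for n
      using N_add[of "u n - v n" "v n - w n"] by (simp add: c closed)
    moreover have "(\<lambda>n. N (u n - v n) + N (v n - w n)) \<longlonglongrightarrow> 0"
      using * by (auto simp: rel_iff intro!: tendsto_add_zero)
    ultimately have "(\<lambda>n. N (u n - w n)) \<longlonglongrightarrow> 0"
      by (intro tendsto_0_dominated[of "\<lambda>n. u n - w n"]) (auto intro: closed c)
    thus "(u, w) \<in> sa_rel A" using * by (simp add: rel_iff)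
  qed
qed (auto simp: refl_on_def rel_iff N_zero)

lemma cls_eqI:
  assumes "u \<in> sa_Cauchy A" "v \<in> sa_Cauchy A" "(\<lambda>n. N (u n - v n)) \<longlonglongrightarrow> 0"
  shows "cls u = cls v"
  unfolding cls_def using assms by (intro equiv_class_eq[OF equiv_rel]) (simp add: rel_iff)

lemma cls_carrier: "u \<in> sa_Cauchy A \<Longrightarrow> cls u \<in> sa_carrier B"
  by (simp add: enveloping_cstar_def cls_def quotientI)

lemma carrier_cases:
  assumes "P \<in> sa_carrier B"
  obtains u where "u \<in> sa_Cauchy A" "P = cls u"
  using assms by (auto simp: enveloping_cstar_def cls_def elim: quotientE)

lemma self_in_cls: "u \<in> sa_Cauchy A \<Longrightarrow> u \<in> cls u"
  unfolding cls_def by (rule equiv_class_self[OF equiv_rel])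

lemma in_cls: "v \<in> cls u \<Longrightarrow> u \<in> sa_Cauchy A \<and> v \<in> sa_Cauchy A \<and> (\<lambda>n. N (u n - v n)) \<longlonglongrightarrow> 0"
  by (auto simp: cls_def rel_iff)

lemma cls_add:
  assumes "u \<in> sa_Cauchy A" "v \<in> sa_Cauchy A"
  shows "sa_add B (cls u) (cls v) = cls (\<lambda>n. u n + v n)"
proof -
  have eq: "cls (\<lambda>n. u' n + v' n) = cls (\<lambda>n. u n + v n)" if "u' \<in> cls u" "v' \<in> cls v" for u' v'
  proof (rule cls_eqI[symmetric])
    note * = in_cls[OF that(1)] in_cls[OF that(2)]
    show "(\<lambda>n. N (u n + v n - (u' n + v' n))) \<longlonglongrightarrow> 0"
    proof (rule tendsto_0_dominated)
      fix n
      show "N (u n + v n - (u' n + v' n)) \<le> N (u n - u' n) + N (v n - v' n)"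
        using N_add[of "u n - u' n" "v n - v' n"] *
        by (simp add: closed Cauchy_carrier algebra_simps)
    qed (use * in \<open>auto simp: closed Cauchy_carrier intro!: tendsto_add_zero\<close>)
  qed (use in_cls[OF that(1)] in_cls[OF that(2)] in \<open>auto intro: Cauchy_add\<close>)
  have "sa_add B (cls u) (cls v) = (\<Union>u'\<in>cls u. \<Union>v'\<in>cls v. cls (\<lambda>n. u' n + v' n))"
    by (simp add: enveloping_cstar_def cls_def add_eq)
  also have "\<dots> = cls (\<lambda>n. u n + v n)" using eq self_in_cls assms by blast
  finally show ?thesis .
qed

lemma cls_mult:
  assumes "u \<in> sa_Cauchy A" "v \<in> sa_Cauchy A"
  shows "sa_mult B (cls u) (cls v) = cls (\<lambda>n. u n \<odot> v n)"
proof -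
  have eq: "cls (\<lambda>n. u' n \<odot> v' n) = cls (\<lambda>n. u n \<odot> v n)" if "u' \<in> cls u" "v' \<in> cls v" for u' v'
  proof (rule cls_eqI[symmetric])
    note * = in_cls[OF that(1)] in_cls[OF that(2)]
    obtain K where K: "\<And>n. N (u' n) \<le> K" using Cauchy_bounded * by blast
    obtain L where L: "\<And>n. N (v n) \<le> L" using Cauchy_bounded * by blast
    show "(\<lambda>n. N (u n \<odot> v n - u' n \<odot> v' n)) \<longlonglongrightarrow> 0"
    proof (rule tendsto_0_dominated)
      fix n
      have "N (u n \<odot> v n - u' n \<odot> v' n) \<le> N (v n) * N (u n - u' n) + N (u' n) * N (v n - v' n)"
        using * by (intro mult_diff_mult) (auto intro: Cauchy_carrier)
      also have "\<dots> \<le> L * N (u n - u' n) + K * N (v n - v' n)"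
        using * K L by (intro add_mono mult_right_mono N_nonneg closed) (auto intro: Cauchy_carrier)
      finally show "N (u n \<odot> v n - u' n \<odot> v' n) \<le> L * N (u n - u' n) + K * N (v n - v' n)" .
    qed (use * in \<open>auto simp: closed Cauchy_carrier intro!: tendsto_add_zero tendsto_mult_right_zero\<close>)
  qed (use in_cls[OF that(1)] in_cls[OF that(2)] in \<open>auto intro: Cauchy_mult\<close>)
  have "sa_mult B (cls u) (cls v) = (\<Union>u'\<in>cls u. \<Union>v'\<in>cls v. cls (\<lambda>n. u' n \<odot> v' n))"
    by (simp add: enveloping_cstar_def cls_def)
  also have "\<dots> = cls (\<lambda>n. u n \<odot> v n)" using eq self_in_cls assms by blast
  finally show ?thesis .
qed

lemma cls_scale:
  assumes "u \<in> sa_Cauchy A"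
  shows "sa_scale B c (cls u) = cls (\<lambda>n. sa_scale A c (u n))"
proof -
  have eq: "cls (\<lambda>n. sa_scale A c (u' n)) = cls (\<lambda>n. sa_scale A c (u n))" if "u' \<in> cls u" for u'
  proof (rule cls_eqI[symmetric])
    note * = in_cls[OF that(1)]
    show "(\<lambda>n. N (sa_scale A c (u n) - sa_scale A c (u' n))) \<longlonglongrightarrow> 0"
    proof (rule tendsto_0_dominated)
      fix n
      show "N (sa_scale A c (u n) - sa_scale A c (u' n)) \<le> cmod c * N (u n - u' n)"
        using N_scale[of "u n - u' n" c] * by (simp add: closed Cauchy_carrier scale_diff)
    qed (use * in \<open>auto simp: closed Cauchy_carrier intro!: tendsto_mult_right_zero\<close>)
  qed (use in_cls[OF that(1)] in \<open>auto intro: Cauchy_scale\<close>)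
  have "sa_scale B c (cls u) = (\<Union>u'\<in>cls u. cls (\<lambda>n. sa_scale A c (u' n)))"
    by (simp add: enveloping_cstar_def cls_def)
  also have "\<dots> = cls (\<lambda>n. sa_scale A c (u n))" using eq self_in_cls assms by blast
  finally show ?thesis .
qed

lemma cls_star:
  assumes "u \<in> sa_Cauchy A"
  shows "sa_star B (cls u) = cls (\<lambda>n. sa_star A (u n))"
proof -
  have eq: "cls (\<lambda>n. sa_star A (u' n)) = cls (\<lambda>n. sa_star A (u n))" if "u' \<in> cls u" for u'
  proof (rule cls_eqI[symmetric])
    note * = in_cls[OF that(1)]
    show "(\<lambda>n. N (sa_star A (u n) - sa_star A (u' n))) \<longlonglongrightarrow> 0"
    proof (rule tendsto_0_dominated)
      fix n
      show "N (sa_star A (u n) - sa_star A (u' n)) \<le> N (u n - u' n)"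
        using N_star[of "u n - u' n"] * by (simp add: closed Cauchy_carrier star_diff)
    qed (use * in \<open>auto simp: closed Cauchy_carrier\<close>)
  qed (use in_cls[OF that(1)] in \<open>auto intro: Cauchy_star\<close>)
  have "sa_star B (cls u) = (\<Union>u'\<in>cls u. cls (\<lambda>n. sa_star A (u' n)))"
    by (simp add: enveloping_cstar_def cls_def)
  also have "\<dots> = cls (\<lambda>n. sa_star A (u n))" using eq self_in_cls assms by blast
  finally show ?thesis .
qed

lemma enveloping_map_eq: "enveloping_map A a = cls (\<lambda>_. a)"
  by (simp add: enveloping_map_def cls_def)

lemma cls_shift:
  assumes "u \<in> sa_Cauchy A"
  shows "cls (\<lambda>n. u (n + k)) = cls u"
proof (rule cls_eqI[OF Cauchy_shift[OF assms] assms])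
  show "(\<lambda>n. N (u (n + k) - u n)) \<longlonglongrightarrow> 0"
  proof (rule LIMSEQ_I)
    fix r :: real assume "r > 0"
    then obtain M where "\<And>m n. m \<ge> M \<Longrightarrow> n \<ge> M \<Longrightarrow> N (u m - u n) < r" using CauchyD[OF assms] by blast
    thus "\<exists>no. \<forall>n\<ge>no. norm (N (u (n + k) - u n) - 0) < r"
      using N_nonneg[OF diff_closed[OF Cauchy_carrier[OF assms] Cauchy_carrier[OF assms]]]
      by (intro exI[of _ M]) auto
  qed
qed


section \<open>Characters of the completion\<close>

text \<open>Partial sums of the geometric series without the constant term:
  \<open>neumann a k = a + a\<^sup>2 + \<dots> + a\<^sup>k\<close>. Horner's form makes the remainder
  \<open>a + a w - w\<close> satisfy a recursion by distributivity alone.\<close>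

primrec neumann :: "'a \<Rightarrow> nat \<Rightarrow> 'a" where
  "neumann a 0 = 0"
| "neumann a (Suc k) = a + a \<odot> neumann a k"

lemma neumann_closed: "a \<in> sa_carrier A \<Longrightarrow> neumann a k \<in> sa_carrier A"
  by (induction k) (auto intro: closed)

lemma mult_zero_right: "a \<in> sa_carrier A \<Longrightarrow> a \<odot> 0 = 0"
  using mult_add_right[OF zero_closed zero_closed, of a] by simp

lemma neumann_remainder:
  assumes a: "a \<in> sa_carrier A" and r: "N a \<le> r"
  shows "N (a + a \<odot> neumann a k - neumann a k) \<le> r ^ Suc k"
proof (induction k)
  case 0
  show ?case using r by (simp add: mult_zero_right a)
next
  case (Suc k)
  let ?w = "neumann a k"
  have w: "?w \<in> sa_carrier A" by (rule neumann_closed[OF a])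
  have "a + a \<odot> neumann a (Suc k) - neumann a (Suc k) = a \<odot> (a + a \<odot> ?w - ?w)"
    using a w by (simp add: mult_diff_right closed)
  also have "N \<dots> \<le> N a * N (a + a \<odot> ?w - ?w)" using a w by (intro N_mult closed)
  also have "\<dots> \<le> r * r ^ Suc k"
    using a w r Suc order_trans[OF N_nonneg[OF a] r] by (intro mult_mono N_nonneg closed) auto
  finally show ?case by simp
qed

lemma N_neumann:
  assumes a: "a \<in> sa_carrier A" and r: "N a \<le> r" "r < 1"
  shows "N (neumann a k) \<le> r / (1 - r)"
proof (induction k)
  have r0: "r \<ge> 0" using N_nonneg[OF a] r by simp
  case 0
  show ?case using r0 r by (simp add: N_zero)
next
  have r0: "r \<ge> 0" using N_nonneg[OF a] r by simp
  case (Suc k)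
  let ?w = "neumann a k"
  have w: "?w \<in> sa_carrier A" by (rule neumann_closed[OF a])
  have "N (neumann a (Suc k)) \<le> N a + N (a \<odot> ?w)" using a w by (auto intro!: N_add closed)
  also have "\<dots> \<le> N a + N a * N ?w" using a w by (intro add_mono N_mult) auto
  also have "\<dots> \<le> r + r * (r / (1 - r))"
    using a w r Suc r0 by (intro add_mono mult_mono N_nonneg closed) auto
  also have "\<dots> = r / (1 - r)" using r by (simp add: field_simps)
  finally show ?case .
qed

text \<open>The diagonal \<open>neumann (u n) n\<close> represents the quasi-inverse of \<open>u\<close>. It is Cauchy because
  multiplication by \<open>1 - u n\<close> is bounded below by \<open>1 - r\<close> and takes the difference of two
  terms to \<open>(u n - u m) (1 + w m)\<close>, up to the remainders.\<close>

lemma quasi_inverse_exists: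
  assumes u: "u \<in> sa_Cauchy A" and r: "\<And>n. N (u n) \<le> r" "r < 1"
  shows "\<exists>w\<in>sa_Cauchy A. cls w = cls (\<lambda>n. u n + u n \<odot> w n)"
proof -
  have uc: "u n \<in> sa_carrier A" for n by (rule Cauchy_carrier[OF u])
  have r0: "r \<ge> 0" using N_nonneg[OF uc[of 0]] r(1)[of 0] by simp
  define w where "w n = neumann (u n) n" for n
  define d where "d n = u n + u n \<odot> w n - w n" for n
  have wc: "w n \<in> sa_carrier A" for n unfolding w_def by (rule neumann_closed[OF uc])
  have dc: "d n \<in> sa_carrier A" for n unfolding d_def by (intro closed uc wc)
  have Nd: "N (d n) \<le> r ^ Suc n" for n unfolding d_def w_def by (rule neumann_remainder[OF uc r(1)])
  have Nw: "N (w n) \<le> r / (1 - r)" for n unfolding w_def by (rule N_neumann[OF uc r(1) r(2)])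
  have key: "N (w n - w m) \<le> (N (u n - u m) * (1 / (1 - r)) + (r ^ Suc n + r ^ Suc m)) / (1 - r)" for n m
  proof -
    let ?x = "w n - w m"
    \<comment> \<open>The term with \<open>u n\<close> is absorbed on the left, as \<open>N (u n) \<le> r < 1\<close>.\<close>
    have "?x = u n \<odot> ?x + ((u n - u m) + (u n - u m) \<odot> w m) + (d m - d n)"
      using uc wc by (simp add: d_def mult_diff_left mult_diff_right)
    hence "N ?x = N (u n \<odot> ?x + ((u n - u m) + (u n - u m) \<odot> w m) + (d m - d n))" by simp
    also have "\<dots> \<le> N (u n \<odot> ?x) + (N (u n - u m) + N ((u n - u m) \<odot> w m)) + (N (d m) + N (d n))"
      by (intro order_trans[OF N_add] add_mono N_diff closed uc wc dc order_refl)
    also have "\<dots> \<le> r * N ?x + (N (u n - u m) + N (u n - u m) * (r / (1 - r))) + (r ^ Suc m + r ^ Suc n)"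
      using r0 by (intro add_mono order_refl order_trans[OF N_mult] mult_mono N_nonneg closed uc wc dc Nd Nw r(1))
    also have "N (u n - u m) + N (u n - u m) * (r / (1 - r)) = N (u n - u m) * (1 / (1 - r))"
      using r(2) by (simp add: field_simps)
    finally have "N ?x * (1 - r) \<le> N (u n - u m) * (1 / (1 - r)) + (r ^ Suc n + r ^ Suc m)"
      by (simp add: algebra_simps)
    thus ?thesis using r(2) by (simp add: pos_le_divide_eq)
  qed
  have w: "w \<in> sa_Cauchy A"
    unfolding Cauchy_iff
  proof safe
    fix \<epsilon> :: real assume \<epsilon>: "\<epsilon> > 0"
    define \<delta> where "\<delta> = \<epsilon> * (1 - r) / 3"
    have \<delta>: "\<delta> > 0" "\<delta> * (1 - r) > 0" "\<epsilon> * (1 - r) = 3 * \<delta>"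
      using \<epsilon> r(2) by (simp_all add: \<delta>_def)
    obtain M1 where M1: "\<And>n m. n \<ge> M1 \<Longrightarrow> m \<ge> M1 \<Longrightarrow> N (u n - u m) < \<delta> * (1 - r)"
      using CauchyD[OF u \<delta>(2)] by blast
    have "(\<lambda>n. r ^ Suc n) \<longlonglongrightarrow> 0" using r0 r(2) by (intro LIMSEQ_Suc LIMSEQ_realpow_zero) auto
    then obtain M2 where "\<And>n. n \<ge> M2 \<Longrightarrow> norm (r ^ Suc n - 0) < \<delta>" using LIMSEQ_D \<delta>(1) by blast
    hence M2: "\<And>n. n \<ge> M2 \<Longrightarrow> r ^ Suc n < \<delta>" by (auto simp: abs_less_iff)
    show "\<exists>M. \<forall>n\<ge>M. \<forall>m\<ge>M. N (w n - w m) < \<epsilon>"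
    proof (intro exI[of _ "max M1 M2"] allI impI)
      fix n m assume "max M1 M2 \<le> n" "max M1 M2 \<le> m"
      hence "N (u n - u m) < \<delta> * (1 - r)" and p: "r ^ Suc n < \<delta>" "r ^ Suc m < \<delta>"
        using M1[of n m] M2[of n] M2[of m] by auto
      hence "N (u n - u m) * (1 / (1 - r)) < \<delta>" using r(2) by (simp add: pos_divide_less_eq)
      hence "N (u n - u m) * (1 / (1 - r)) + (r ^ Suc n + r ^ Suc m) < \<epsilon> * (1 - r)"
        using p \<delta>(3) by linarith
      hence "(N (u n - u m) * (1 / (1 - r)) + (r ^ Suc n + r ^ Suc m)) / (1 - r) < \<epsilon>"
        using r(2) by (simp only: pos_divide_less_eq diff_gt_0_iff_gt)
      thus "N (w n - w m) < \<epsilon>" using key[of n m] by simp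
    qed
  qed (rule wc)
  have "cls (\<lambda>n. u n + u n \<odot> w n) = cls w"
  proof (rule cls_eqI)
    have "(\<lambda>n. r ^ Suc n) \<longlonglongrightarrow> 0" using r0 r(2) by (intro LIMSEQ_Suc LIMSEQ_realpow_zero) auto
    thus "(\<lambda>n. N (u n + u n \<odot> w n - w n)) \<longlonglongrightarrow> 0"
      using tendsto_0_dominated[OF dc Nd] by (simp add: d_def)
  qed (intro Cauchy_add Cauchy_mult u w)+
  thus ?thesis using w by (intro bexI[of _ w]) auto
qed

lemma character_cls:
  assumes "\<phi> \<in> characters B" "u \<in> sa_Cauchy A"
  shows "v \<in> sa_Cauchy A \<Longrightarrow> \<phi> (cls (\<lambda>n. u n + v n)) = \<phi> (cls u) + \<phi> (cls v)"
    and "v \<in> sa_Cauchy A \<Longrightarrow> \<phi> (cls (\<lambda>n. u n \<odot> v n)) = \<phi> (cls u) * \<phi> (cls v)"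
    and "\<phi> (cls (\<lambda>n. sa_scale A c (u n))) = c * \<phi> (cls u)"
    and "\<phi> (cls (\<lambda>n. sa_star A (u n))) = cnj (\<phi> (cls u))"
proof -
  have \<phi>: "\<And>a b. a \<in> sa_carrier B \<Longrightarrow> b \<in> sa_carrier B \<Longrightarrow> \<phi> (sa_add B a b) = \<phi> a + \<phi> b"
    "\<And>a b. a \<in> sa_carrier B \<Longrightarrow> b \<in> sa_carrier B \<Longrightarrow> \<phi> (sa_mult B a b) = \<phi> a * \<phi> b"
    "\<And>a c. a \<in> sa_carrier B \<Longrightarrow> \<phi> (sa_scale B c a) = c * \<phi> a"
    "\<And>a. a \<in> sa_carrier B \<Longrightarrow> \<phi> (sa_star B a) = cnj (\<phi> a)"
    using assms(1) by (simp_all add: characters_def)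
  show "v \<in> sa_Cauchy A \<Longrightarrow> \<phi> (cls (\<lambda>n. u n + v n)) = \<phi> (cls u) + \<phi> (cls v)"
    and "v \<in> sa_Cauchy A \<Longrightarrow> \<phi> (cls (\<lambda>n. u n \<odot> v n)) = \<phi> (cls u) * \<phi> (cls v)"
    and "\<phi> (cls (\<lambda>n. sa_scale A c (u n))) = c * \<phi> (cls u)"
    and "\<phi> (cls (\<lambda>n. sa_star A (u n))) = cnj (\<phi> (cls u))"
    using \<phi> cls_carrier assms(2)
    by (simp_all flip: cls_add cls_mult cls_scale cls_star)
qed

text \<open>Automatic continuity: if \<open>|\<phi> u|\<close> exceeded a bound of the norm of \<open>u\<close>, a multiple of \<open>u\<close>
  would have norm less than 1 and value 1, and its quasi-inverse \<open>w = u + u w\<close> would give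
  \<open>\<phi> w = 1 + \<phi> w\<close>.\<close>

lemma character_contractive:
  assumes \<phi>: "\<phi> \<in> characters B" and u: "u \<in> sa_Cauchy A" and r: "\<And>n. n \<ge> K \<Longrightarrow> N (u n) \<le> r"
  shows "cmod (\<phi> (cls u)) \<le> r"
proof (rule ccontr)
  assume "\<not> ?thesis"
  hence *: "r < cmod (\<phi> (cls u))" by simp
  define z where "z = \<phi> (cls u)"
  have r0: "r \<ge> 0" using N_nonneg[OF Cauchy_carrier[OF u], of K] r[of K] by simp
  have z0: "cmod z > 0" using * r0 unfolding z_def by linarith
  \<comment> \<open>The shift turns the eventual bound into one for all terms.\<close>
  define v where "v n = sa_scale A (inverse z) (u (n + K))" for n
  have v: "v \<in> sa_Cauchy A" unfolding v_def by (intro Cauchy_scale Cauchy_shift u)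
  have "N (v n) \<le> r / cmod z" for n
  proof -
    have "N (v n) \<le> cmod (inverse z) * N (u (n + K))"
      unfolding v_def by (intro N_scale Cauchy_carrier u)
    also have "\<dots> \<le> cmod (inverse z) * r" by (intro mult_left_mono r) auto
    finally show ?thesis by (simp add: norm_inverse divide_inverse mult.commute)
  qed
  moreover have "r / cmod z < 1" using * z0 by (simp add: z_def)
  ultimately obtain w where w: "w \<in> sa_Cauchy A" "cls w = cls (\<lambda>n. v n + v n \<odot> w n)"
    using quasi_inverse_exists[OF v] by blast
  have "\<phi> (cls v) = 1"
    using z0 character_cls(3)[OF \<phi> Cauchy_shift[OF u, of K], of "inverse z"]
    by (simp add: v_def[abs_def] cls_shift[OF u] z_def)
  hence "\<phi> (cls w) = 1 + \<phi> (cls w)"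
    using w(1) v arg_cong[OF w(2), of \<phi>] by (simp add: character_cls[OF \<phi>] Cauchy_mult)
  thus False by simp
qed

lemma character_diff:
  assumes "\<phi> \<in> characters B" "u \<in> sa_Cauchy A" "v \<in> sa_Cauchy A"
  shows "\<phi> (cls (\<lambda>n. u n - v n)) = \<phi> (cls u) - \<phi> (cls v)" "(\<lambda>n. u n - v n) \<in> sa_Cauchy A"
proof -
  have eq: "(\<lambda>n. u n - v n) = (\<lambda>n. u n + sa_scale A (-1) (v n))"
    using Cauchy_carrier[OF assms(3)] by (simp add: scale_minus_one)
  show "\<phi> (cls (\<lambda>n. u n - v n)) = \<phi> (cls u) - \<phi> (cls v)"
    unfolding eq using assms(2,3) by (simp add: character_cls[OF assms(1)] Cauchy_scale)
  show "(\<lambda>n. u n - v n) \<in> sa_Cauchy A"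
    unfolding eq using assms by (simp add: Cauchy_add Cauchy_scale)
qed

text \<open>The threshold \<open>M\<close> is the same for all characters, since all of them are contractive.\<close>

lemma characters_approx:
  assumes u: "u \<in> sa_Cauchy A" and "\<epsilon> > 0"
  obtains M where "\<And>\<phi> m. \<phi> \<in> characters B \<Longrightarrow> m \<ge> M \<Longrightarrow>
    cmod (\<phi> (enveloping_map A (u m)) - \<phi> (cls u)) < \<epsilon>"
proof -
  obtain M where M: "\<And>m n. m \<ge> M \<Longrightarrow> n \<ge> M \<Longrightarrow> N (u m - u n) < \<epsilon>/2"
    using CauchyD[OF u, of "\<epsilon>/2"] \<open>\<epsilon> > 0\<close> by auto
  have "cmod (\<phi> (enveloping_map A (u m)) - \<phi> (cls u)) < \<epsilon>" if \<phi>: "\<phi> \<in> characters B" and m: "m \<ge> M" for \<phi> m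
  proof -
    have c: "(\<lambda>_. u m) \<in> sa_Cauchy A" by (intro Cauchy_const Cauchy_carrier u)
    have "cmod (\<phi> (cls (\<lambda>n. u m - u n))) \<le> \<epsilon>/2"
      by (rule character_contractive[OF \<phi> character_diff(2)[OF \<phi> c u], of M])
         (use M m in \<open>auto intro: less_imp_le\<close>)
    thus ?thesis using \<open>\<epsilon> > 0\<close> character_diff(1)[OF \<phi> c u] by (simp add: enveloping_map_eq)
  qed
  thus ?thesis using that by blast
qed

corollary character_tendsto:
  assumes "\<phi> \<in> characters B" "u \<in> sa_Cauchy A"
  shows "(\<lambda>m. \<phi> (enveloping_map A (u m))) \<longlonglongrightarrow> \<phi> (cls u)"
  by (rule LIMSEQ_I) (metis characters_approx[OF assms(2)] assms(1))

lemma characters_eqI: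
  assumes "\<phi> \<in> characters B" "\<phi>' \<in> characters B"
    and "\<And>a. a \<in> sa_carrier A \<Longrightarrow> \<phi> (enveloping_map A a) = \<phi>' (enveloping_map A a)"
  shows "\<phi> = \<phi>'"
proof (rule extensionalityI[of _ "sa_carrier B"])
  fix P assume "P \<in> sa_carrier B"
  then obtain u where u: "u \<in> sa_Cauchy A" "P = cls u" by (rule carrier_cases)
  show "\<phi> P = \<phi>' P"
    using character_tendsto[OF assms(1) u(1)] character_tendsto[OF assms(2) u(1)]
      Cauchy_carrier[OF u(1)] LIMSEQ_unique unfolding u(2) by (simp add: assms(3))
qed (use assms in \<open>auto simp: characters_def\<close>)

lemma character_restrict:
  assumes \<phi>: "\<phi> \<in> characters B"
  shows "restrict (\<lambda>a. \<phi> (enveloping_map A a)) (sa_carrier A) \<in> characters A"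
proof -
  have "\<exists>a\<in>sa_carrier A. \<phi> (enveloping_map A a) \<noteq> 0"
  proof (rule ccontr)
    assume *: "\<not> ?thesis"
    obtain P where P: "P \<in> sa_carrier B" "\<phi> P \<noteq> 0" using \<phi> by (auto simp: characters_def)
    obtain u where u: "u \<in> sa_Cauchy A" "P = cls u" using P(1) by (rule carrier_cases)
    have "(\<lambda>m. 0) \<longlonglongrightarrow> \<phi> P"
      using character_tendsto[OF \<phi> u(1)] * Cauchy_carrier[OF u(1)] by (simp add: u(2))
    thus False using P(2) LIMSEQ_const_iff by metis
  qed
  thus ?thesis
    using character_cls(1,2)[OF \<phi> Cauchy_const, OF _ Cauchy_const] character_cls(3,4)[OF \<phi> Cauchy_const]
    by (auto simp: characters_def enveloping_map_eq add_eq closed)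
qed

lemma abs_character_seminorm:
  assumes "\<omega> \<in> characters A"
  shows "cstar_seminorm A (\<lambda>a. cmod (\<omega> a))"
  using assms
  by (auto simp: cstar_seminorm_def characters_def norm_mult norm_triangle_ineq star_closed
      power2_eq_square)

text \<open>The absolute value of a character of \<open>A\<close> is a C*-seminorm, hence bounded by the universal
  one; so the character maps Cauchy sequences to convergent ones.\<close>

lemma character_extend:
  assumes \<omega>: "\<omega> \<in> characters A"
  shows "\<exists>\<phi>\<in>characters B. \<forall>a\<in>sa_carrier A. \<phi> (enveloping_map A a) = \<omega> a"
proof -
  have \<omega>_hom: "\<And>a b. a \<in> sa_carrier A \<Longrightarrow> b \<in> sa_carrier A \<Longrightarrow> \<omega> (a + b) = \<omega> a + \<omega> b"
    "\<And>a b. a \<in> sa_carrier A \<Longrightarrow> b \<in> sa_carrier A \<Longrightarrow> \<omega> (a \<odot> b) = \<omega> a * \<omega> b"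
    "\<And>a c. a \<in> sa_carrier A \<Longrightarrow> \<omega> (sa_scale A c a) = c * \<omega> a"
    "\<And>a. a \<in> sa_carrier A \<Longrightarrow> \<omega> (sa_star A a) = cnj (\<omega> a)"
    using \<omega> by (auto simp: characters_def add_eq)
  have bound: "cmod (\<omega> a - \<omega> b) \<le> N (a - b)" if "a \<in> sa_carrier A" "b \<in> sa_carrier A" for a b
    using seminorm_le_N[OF abs_character_seminorm[OF \<omega>], of "a - b"] \<omega>_hom(1)[of "a - b" b] that
    by (simp add: closed)
  have conv: "convergent (\<lambda>n. \<omega> (u n))" if u: "u \<in> sa_Cauchy A" for u
  proof (rule Cauchy_convergent, rule metric_CauchyI)
    fix e :: real assume "e > 0"
    then obtain M where "\<And>m n. m \<ge> M \<Longrightarrow> n \<ge> M \<Longrightarrow> N (u m - u n) < e" using CauchyD[OF u] by blast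
    thus "\<exists>M. \<forall>m\<ge>M. \<forall>n\<ge>M. dist (\<omega> (u m)) (\<omega> (u n)) < e"
      using bound[OF Cauchy_carrier[OF u] Cauchy_carrier[OF u]]
      by (metis dist_norm order_le_less_trans)
  qed
  define \<phi> where "\<phi> = restrict (\<lambda>P. lim (\<lambda>n. \<omega> ((SOME u. u \<in> P) n))) (sa_carrier B)"
  have \<phi>_lim: "(\<lambda>n. \<omega> (u n)) \<longlonglongrightarrow> \<phi> (cls u)" if u: "u \<in> sa_Cauchy A" for u
  proof -
    define v where "v = (SOME v. v \<in> cls u)"
    have "v \<in> cls u" unfolding v_def using self_in_cls[OF u] by (rule someI[of "\<lambda>v. v \<in> cls u"])
    hence v: "v \<in> sa_Cauchy A" "(\<lambda>n. N (u n - v n)) \<longlonglongrightarrow> 0" by (auto dest: in_cls)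
    have "(\<lambda>n. \<omega> (v n)) \<longlonglongrightarrow> \<phi> (cls u)"
      using conv[OF v(1)] cls_carrier[OF u] by (simp add: \<phi>_def v_def convergent_LIMSEQ_iff)
    moreover have "(\<lambda>n. \<omega> (u n) - \<omega> (v n)) \<longlonglongrightarrow> 0"
      by (rule Lim_null_comparison[OF _ v(2)])
         (use bound[OF Cauchy_carrier[OF u] Cauchy_carrier[OF v(1)]] in auto)
    ultimately show ?thesis using tendsto_add by fastforce
  qed
  have \<phi>_eq: "\<phi> (cls u) = l" if "u \<in> sa_Cauchy A" "(\<lambda>n. \<omega> (u n)) \<longlonglongrightarrow> l" for u l
    using \<phi>_lim[OF that(1)] that(2) by (rule LIMSEQ_unique)
  have ext: "\<phi> (enveloping_map A a) = \<omega> a" if "a \<in> sa_carrier A" for a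
    unfolding enveloping_map_eq by (rule \<phi>_eq[OF Cauchy_const[OF that]]) simp
  have "\<phi> \<in> characters B"
    unfolding characters_def
  proof safe
    show "\<phi> \<in> extensional (sa_carrier B)" by (simp add: \<phi>_def)
  next
    fix P Q assume "P \<in> sa_carrier B" "Q \<in> sa_carrier B"
    then obtain u v where uv: "u \<in> sa_Cauchy A" "P = cls u" "v \<in> sa_Cauchy A" "Q = cls v"
      using carrier_cases by metis
    note c = uv(1,3)[THEN Cauchy_carrier] and l = uv(1,3)[THEN \<phi>_lim]
    show "\<phi> (sa_add B P Q) = \<phi> P + \<phi> Q"
      using tendsto_add[OF l] uv by (auto simp: cls_add \<omega>_hom c intro!: \<phi>_eq Cauchy_add)
    show "\<phi> (sa_mult B P Q) = \<phi> P * \<phi> Q"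
      using tendsto_mult[OF l] uv by (auto simp: cls_mult \<omega>_hom c intro!: \<phi>_eq Cauchy_mult)
  next
    fix P c assume "P \<in> sa_carrier B"
    then obtain u where u: "u \<in> sa_Cauchy A" "P = cls u" using carrier_cases by metis
    note c = u(1)[THEN Cauchy_carrier] and l = u(1)[THEN \<phi>_lim]
    show "\<phi> (sa_scale B c P) = c * \<phi> P"
      using tendsto_mult_left[OF l] u by (auto simp: cls_scale \<omega>_hom c intro!: \<phi>_eq Cauchy_scale)
    show "\<phi> (sa_star B P) = cnj (\<phi> P)"
      using tendsto_cnj[OF l] u by (auto simp: cls_star \<omega>_hom c intro!: \<phi>_eq Cauchy_star)
  next
    obtain a where "a \<in> sa_carrier A" "\<omega> a \<noteq> 0" using \<omega> by (auto simp: characters_def)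
    thus "\<exists>P\<in>sa_carrier B. \<phi> P \<noteq> 0"
      using ext by (intro bexI[of _ "enveloping_map A a"])
        (auto simp: enveloping_map_eq intro: cls_carrier Cauchy_const)
  qed
  thus ?thesis using ext by blast
qed

lemma topspace_Sp: "topspace (Sp B) = characters B"
  by (auto simp: Sp_def characters_def PiE_def)

text \<open>On characters, pointwise convergence on the completion is pointwise convergence on the dense
  image of \<open>A\<close>, because the approximation of an element by elements of \<open>A\<close> is uniform over
  all characters.\<close>

lemma continuous_map_into_Sp:
  assumes char: "\<And>z. z \<in> topspace Z \<Longrightarrow> f z \<in> characters B"
    and cont: "\<And>a. a \<in> sa_carrier A \<Longrightarrow> continuous_map Z euclidean (\<lambda>z. f z (enveloping_map A a))"
  shows "continuous_map Z (Sp B) f"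
  unfolding Sp_def continuous_map_in_subtopology continuous_map_componentwise
proof (intro conjI ballI)
  fix P assume "P \<in> sa_carrier B"
  then obtain u where u: "u \<in> sa_Cauchy A" "P = cls u" by (rule carrier_cases)
  have "continuous_map Z Met_TC.mtopology (\<lambda>z. f z P)"
  proof (rule Met_TC.continuous_map_uniform_limit[where f = "\<lambda>m z. f z (enveloping_map A (u m))"])
    show "\<forall>\<^sub>F m in sequentially. continuous_map Z Met_TC.mtopology (\<lambda>z. f z (enveloping_map A (u m)))"
      using cont[OF Cauchy_carrier[OF u(1)]] by simp
    fix \<epsilon> :: real assume "\<epsilon> > 0"
    then obtain M where "\<And>\<phi> m. \<phi> \<in> characters B \<Longrightarrow> m \<ge> M \<Longrightarrow>
        cmod (\<phi> (enveloping_map A (u m)) - \<phi> (cls u)) < \<epsilon>"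
      using characters_approx[OF u(1)] by blast
    thus "\<forall>\<^sub>F m in sequentially. \<forall>z\<in>topspace Z. f z P \<in> UNIV \<and>
        dist (f z (enveloping_map A (u m))) (f z P) < \<epsilon>"
      using char by (auto simp: eventually_sequentially u(2) dist_norm)
  qed simp
  thus "continuous_map Z euclidean (\<lambda>z. f z P)" by simp
qed (use char in \<open>auto simp: characters_def\<close>)

lemma continuous_map_Sp_eval:
  "a \<in> sa_carrier A \<Longrightarrow> continuous_map (Sp B) euclidean (\<lambda>\<phi>. \<phi> (enveloping_map A a))"
  unfolding Sp_def enveloping_map_eq
  by (intro continuous_map_from_subtopology continuous_map_product_projection cls_carrier Cauchy_const)

end

section \<open>C*-seminorms on C0 are bounded by the supremum norm\<close>

text \<open>Multiplication by a bounded continuous \<open>u\<close> with \<open>|u| = 1\<close> preserves \<open>q\<close>, by the C*-identity.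
  For \<open>0 \<le> h \<le> 1\<close> the function \<open>h\<close> is the mean of two such functions,
  \<open>h + i (1 - h\<^sup>2)\<^sup>1\<^sup>/\<^sup>2\<close> and its conjugate, so that \<open>(q h)\<^sup>2 = q (h h) \<le> q h\<close> and \<open>q h \<le> 1\<close>.
  The general case is \<open>h = |g|\<^sup>2 / M\<^sup>2\<close>.\<close>

lemma C0_cstar_seminorm_le_sup:
  fixes q :: "('x \<Rightarrow> complex) \<Rightarrow> real"
  assumes nonneg: "\<And>g. g \<in> C0 Y \<Longrightarrow> q g \<ge> 0"
    and add: "\<And>g h. g \<in> C0 Y \<Longrightarrow> h \<in> C0 Y \<Longrightarrow> q (\<lambda>x. g x + h x) \<le> q g + q h"
    and scale: "\<And>c g. g \<in> C0 Y \<Longrightarrow> q (\<lambda>x. c * g x) = cmod c * q g"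
    and cstar: "\<And>g. g \<in> C0 Y \<Longrightarrow> q (\<lambda>x. cnj (g x) * g x) = (q g)\<^sup>2"
    and g: "g \<in> C0 Y" and M: "M > 0" "\<And>x. cmod (g x) \<le> M"
  shows "q g \<le> M"
proof -
  have unitary: "q (\<lambda>x. z x * u x) = q z"
    if z: "z \<in> C0 Y" and u: "continuous_map Y euclidean u" "\<And>x. x \<in> topspace Y \<Longrightarrow> cmod (u x) = 1"
    for z u
  proof -
    have zu: "(\<lambda>x. z x * u x) \<in> C0 Y" using C0_mult_bounded[OF z u(1), of 1] u(2) by simp
    have "(\<lambda>x. cnj (z x * u x) * (z x * u x)) = (\<lambda>x. cnj (z x) * z x)"
    proof
      fix x
      show "cnj (z x * u x) * (z x * u x) = cnj (z x) * z x"
      proof (cases "x \<in> topspace Y")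
        case True
        hence "cnj (u x) * u x = 1"
          using u(2) complex_norm_square[of "u x"] by (simp add: mult.commute)
        moreover have "cnj (z x * u x) * (z x * u x) = (cnj (z x) * z x) * (cnj (u x) * u x)"
          by (simp add: mult_ac)
        ultimately show ?thesis by simp
      qed (simp add: C0_outside[OF z])
    qed
    hence "(q (\<lambda>x. z x * u x))\<^sup>2 = (q z)\<^sup>2" using cstar[OF zu] cstar[OF z] by simp
    thus ?thesis using nonneg[OF z] nonneg[OF zu] by (simp add: power2_eq_iff_nonneg)
  qed
  define k where "k x = (cmod (g x) / M)\<^sup>2" for x
  have k: "0 \<le> k x" "k x \<le> 1" for x
    using M(1) M(2)[of x] by (auto simp: k_def power_le_one)
  have gg: "(\<lambda>x. cnj (g x) * g x) = (\<lambda>x. complex_of_real (M\<^sup>2) * complex_of_real (k x))"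
  proof
    fix x
    have "cnj (g x) * g x = complex_of_real ((cmod (g x))\<^sup>2)"
      by (simp only: complex_norm_square mult.commute)
    also have "(cmod (g x))\<^sup>2 = M\<^sup>2 * k x" using M(1) by (simp add: k_def power_divide)
    finally show "cnj (g x) * g x = complex_of_real (M\<^sup>2) * complex_of_real (k x)" by simp
  qed
  define h where "h x = complex_of_real (k x)" for x
  have "(\<lambda>x. complex_of_real (inverse (M\<^sup>2)) * (cnj (g x) * g x)) = h"
    using M(1) by (simp only: fun_cong[OF gg]) (simp add: field_simps h_def[abs_def])
  hence h: "h \<in> C0 Y" using C0_scale[OF C0_mult[OF C0_cnj[OF g] g]] by metis
  define s where "s x = complex_of_real (sqrt (1 - (k x)\<^sup>2))" for x
  have ck: "continuous_map Y euclidean k"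
    using C0_continuous[OF g] M(1) unfolding k_def[abs_def]
    by (auto simp: continuous_map_euclidean_iff_tendsto intro!: tendsto_intros)
  have u: "continuous_map Y euclidean (\<lambda>x. h x + \<i> * s x)" "continuous_map Y euclidean (\<lambda>x. h x - \<i> * s x)"
    using ck unfolding s_def h_def
    by (auto simp: continuous_map_euclidean_iff_tendsto intro!: tendsto_intros)
  have norm1: "cmod (h x + \<i> * s x) = 1" "cmod (h x - \<i> * s x) = 1" for x
  proof -
    have "1 - (k x)\<^sup>2 \<ge> 0" using k[of x] by (simp add: power_le_one)
    thus "cmod (h x + \<i> * s x) = 1" "cmod (h x - \<i> * s x) = 1"
      by (simp_all add: cmod_def h_def s_def)
  qed
  have c: "(\<lambda>x. h x * (h x + \<i> * s x)) \<in> C0 Y" "(\<lambda>x. h x * (h x - \<i> * s x)) \<in> C0 Y"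
    using C0_mult_bounded[OF h u(1), of 1] C0_mult_bounded[OF h u(2), of 1] norm1 by auto
  have "(q h)\<^sup>2 = q (\<lambda>x. h x * h x)" using cstar[OF h] by (simp add: h_def)
  also have "(\<lambda>x. h x * h x) = (\<lambda>x. (1/2) * (h x * (h x + \<i> * s x) + h x * (h x - \<i> * s x)))"
    by (simp add: algebra_simps)
  also have "q \<dots> = (1/2) * q (\<lambda>x. h x * (h x + \<i> * s x) + h x * (h x - \<i> * s x))"
    using scale[OF C0_add[OF c], of "1/2"] by simp
  also have "\<dots> \<le> (1/2) * (q (\<lambda>x. h x * (h x + \<i> * s x)) + q (\<lambda>x. h x * (h x - \<i> * s x)))"
    by (intro mult_left_mono add[OF c]) simp
  also have "\<dots> = q h" using unitary[OF h u(1)] unitary[OF h u(2)] norm1 by simp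
  finally have "q h * q h \<le> 1 * q h" by (simp add: power2_eq_square)
  hence "q h \<le> 1" using nonneg[OF h] by (cases "q h = 0") (auto simp: mult_le_cancel_right)
  have "(q g)\<^sup>2 = q (\<lambda>x. complex_of_real (M\<^sup>2) * h x)" using cstar[OF g] gg by (simp add: h_def)
  also have "\<dots> = M\<^sup>2 * q h" using scale[OF h, of "complex_of_real (M\<^sup>2)"] by (simp add: norm_power)
  also have "\<dots> \<le> M\<^sup>2" using \<open>q h \<le> 1\<close> by (simp add: mult_left_le)
  finally show ?thesis using M(1) by (rule power2_le_imp_le[OF _ less_imp_le])
qed

section \<open>The algebra of an action\<close>

locale locally_compact_action =
  fixes X :: "'x topology" and \<theta> :: "'s::inverse_semigroup \<Rightarrow> 'x \<Rightarrow> 'x option"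
  assumes locally_compact: "locally_compact_space X" and Hausdorff: "Hausdorff_space X"
    and action: "semigroup_action X \<theta>"
begin

abbreviation Y :: "'s \<Rightarrow> 'x topology" where "Y e \<equiv> act_space X \<theta> e"
abbreviation alg :: "('s \<Rightarrow> 'x \<Rightarrow> complex) star_algebra" where "alg \<equiv> KS_alg X \<theta>"

lemma Y_spaces:
  assumes "e \<in> idempotents"
  shows "locally_compact_space (Y e)" "Hausdorff_space (Y e)"
  using locally_compact_space_open_subset[OF _ locally_compact openin_act_dom[OF action assms]]
    Hausdorff Hausdorff_space_subtopology by auto

lemma topspace_Y: "e \<in> idempotents \<Longrightarrow> topspace (Y e) = act_dom \<theta> e"
  using openin_subset[OF openin_act_dom[OF action]] by auto

lemma C0_mult_Y:
  assumes "e \<in> idempotents" "f \<in> idempotents" "g \<in> C0 (Y e)" "h \<in> C0 (Y f)"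
  shows "(\<lambda>x. g x * h x) \<in> C0 (Y (e * f))"
  using C0_mult_subtopology[OF Hausdorff assms(3,4)] by (simp add: act_dom_mult[OF action assms(1,2)])

lemma alg_carrier: "a \<in> sa_carrier alg \<longleftrightarrow>
    finite (KS_supp a) \<and> KS_supp a \<subseteq> idempotents \<and> (\<forall>e\<in>idempotents. a e \<in> C0 (Y e))"
  by (simp add: KS_alg_def)

lemma alg_add: "sa_add alg a b = a + b"
  and alg_scale: "sa_scale alg c a = (\<lambda>e x. c * a e x)"
  and alg_star: "sa_star alg a = (\<lambda>e x. cnj (a e x))"
  by (auto simp: KS_alg_def fun_eq_iff)

lemma alg_mult_superset:
  assumes "finite F" "KS_supp a \<subseteq> F" "finite G" "KS_supp b \<subseteq> G"
  shows "sa_mult alg a b k x = (\<Sum>e\<in>F. \<Sum>f\<in>G. KS_single (e * f) (\<lambda>y. a e y * b f y) k x)"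
proof -
  have "(\<Sum>f\<in>KS_supp b. KS_single (e * f) (\<lambda>y. a e y * b f y) k x) =
      (\<Sum>f\<in>G. KS_single (e * f) (\<lambda>y. a e y * b f y) k x)" for e
    using assms by (intro sum.mono_neutral_left) (auto simp: KS_supp_def KS_single_def)
  moreover have "(\<Sum>e\<in>KS_supp a. \<Sum>f\<in>G. KS_single (e * f) (\<lambda>y. a e y * b f y) k x) =
      (\<Sum>e\<in>F. \<Sum>f\<in>G. KS_single (e * f) (\<lambda>y. a e y * b f y) k x)"
    using assms by (intro sum.mono_neutral_left) (auto simp: KS_supp_def KS_single_def)
  ultimately show ?thesis by (simp add: KS_alg_def)
qed

lemma single_apply: "KS_single e g f = (if f = e then g else (\<lambda>_. 0))"
  by (simp add: KS_single_def)

lemma KS_supp_single: "KS_supp (KS_single e g) \<subseteq> {e}"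
  by (auto simp: KS_supp_def KS_single_def)

lemma single_in_alg:
  assumes "e \<in> idempotents" "g \<in> C0 (Y e)"
  shows "KS_single e g \<in> sa_carrier alg"
  using assms KS_supp_single[of e g] C0_zero by (auto simp: alg_carrier finite_subset single_apply)

lemma single_add: "KS_single e (\<lambda>x. g x + h x) = KS_single e g + KS_single e h"
  and single_scale: "KS_single e (\<lambda>x. c * g x) = sa_scale alg c (KS_single e g)"
  and single_star: "KS_single e (\<lambda>x. cnj (g x)) = sa_star alg (KS_single e g)"
  by (auto simp: KS_single_def alg_scale alg_star fun_eq_iff)

lemma single_mult: "KS_single (e * f) (\<lambda>x. g x * h x) = sa_mult alg (KS_single e g) (KS_single f h)"
  by (intro ext, subst alg_mult_superset[of "{e}" _ "{f}"])
     (auto simp: KS_supp_single, simp add: KS_single_def)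

lemma add_in_alg: "a \<in> sa_carrier alg \<Longrightarrow> b \<in> sa_carrier alg \<Longrightarrow> a + b \<in> sa_carrier alg"
proof -
  assume *: "a \<in> sa_carrier alg" "b \<in> sa_carrier alg"
  have "KS_supp (a + b) \<subseteq> KS_supp a \<union> KS_supp b" by (auto simp: KS_supp_def fun_eq_iff)
  moreover have "(a + b) e = (\<lambda>x. a e x + b e x)" for e by (simp add: fun_eq_iff)
  ultimately show ?thesis using * by (auto simp: alg_carrier finite_subset intro: C0_add)
qed

lemma scale_in_alg: "a \<in> sa_carrier alg \<Longrightarrow> sa_scale alg c a \<in> sa_carrier alg"
proof -
  assume *: "a \<in> sa_carrier alg"
  have "KS_supp (sa_scale alg c a) \<subseteq> KS_supp a" by (auto simp: KS_supp_def fun_eq_iff alg_scale)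
  thus ?thesis using * by (auto simp: alg_carrier finite_subset alg_scale intro: C0_scale)
qed

lemma star_in_alg: "a \<in> sa_carrier alg \<Longrightarrow> sa_star alg a \<in> sa_carrier alg"
proof -
  assume *: "a \<in> sa_carrier alg"
  have "KS_supp (sa_star alg a) \<subseteq> KS_supp a" by (auto simp: KS_supp_def fun_eq_iff alg_star)
  thus ?thesis using * by (auto simp: alg_carrier finite_subset alg_star intro: C0_cnj)
qed

lemma KS_supp_mult: "KS_supp (sa_mult alg a b) \<subseteq> (\<lambda>(e, f). e * f) ` (KS_supp a \<times> KS_supp b)"
proof
  fix k assume "k \<in> KS_supp (sa_mult alg a b)"
  then obtain x where "sa_mult alg a b k x \<noteq> 0" by (auto simp: KS_supp_def)
  hence "(\<Sum>e\<in>KS_supp a. \<Sum>f\<in>KS_supp b. KS_single (e * f) (\<lambda>y. a e y * b f y) k x) \<noteq> 0"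
    by (simp add: KS_alg_def)
  then obtain e f where "e \<in> KS_supp a" "f \<in> KS_supp b"
      "KS_single (e * f) (\<lambda>y. a e y * b f y) k x \<noteq> 0"
    by (meson sum.not_neutral_contains_not_neutral)
  thus "k \<in> (\<lambda>(e, f). e * f) ` (KS_supp a \<times> KS_supp b)"
    by (auto simp: KS_single_def split: if_splits)
qed

lemma mult_in_alg:
  assumes a: "a \<in> sa_carrier alg" and b: "b \<in> sa_carrier alg"
  shows "sa_mult alg a b \<in> sa_carrier alg"
proof -
  have fin: "finite (KS_supp (sa_mult alg a b))"
    using a b by (intro finite_subset[OF KS_supp_mult]) (auto simp: alg_carrier)
  have supp: "KS_supp (sa_mult alg a b) \<subseteq> idempotents"
  proof -
    have "(\<lambda>(e, f). e * f) ` (KS_supp a \<times> KS_supp b) \<subseteq> idempotents"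
      using a b by (auto simp: alg_carrier intro!: idempotents_mult)
    thus ?thesis using KS_supp_mult[of a b] by simp
  qed
  have "sa_mult alg a b k \<in> C0 (Y k)" if k: "k \<in> idempotents" for k
  proof -
    have "(\<lambda>x. \<Sum>e\<in>KS_supp a. \<Sum>f\<in>KS_supp b. KS_single (e * f) (\<lambda>y. a e y * b f y) k x) \<in> C0 (Y k)"
    proof (intro C0_sum)
      fix e f assume "e \<in> KS_supp a" "f \<in> KS_supp b"
      hence "(\<lambda>y. a e y * b f y) \<in> C0 (Y (e * f))"
        using a b by (intro C0_mult_Y) (auto simp: alg_carrier)
      thus "KS_single (e * f) (\<lambda>y. a e y * b f y) k \<in> C0 (Y k)"
        by (simp add: single_apply C0_zero)
    qed
    thus ?thesis by (simp add: KS_alg_def)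
  qed
  thus ?thesis using fin supp by (simp add: alg_carrier)
qed

lemma alg_induct [consumes 1, case_names zero add_single]:
  assumes a: "a \<in> sa_carrier alg" and zero: "P 0"
    and step: "\<And>a e g. a \<in> sa_carrier alg \<Longrightarrow> e \<in> idempotents \<Longrightarrow> g \<in> C0 (Y e) \<Longrightarrow> P a \<Longrightarrow>
      P (a + KS_single e g)"
  shows "P a"
proof -
  have "finite F \<Longrightarrow> a \<in> sa_carrier alg \<Longrightarrow> KS_supp a \<subseteq> F \<Longrightarrow> F \<subseteq> idempotents \<Longrightarrow> P a" for F
  proof (induction F arbitrary: a rule: finite_induct)
    case empty
    hence "a = 0" by (auto simp: KS_supp_def fun_eq_iff)
    thus ?case using zero by (simp only:)
  next
    case (insert e F)
    define b where "b = a(e := (\<lambda>_. 0))"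
    have supp: "KS_supp b \<subseteq> F" using insert.prems(2) by (auto simp: b_def KS_supp_def)
    have b: "b \<in> sa_carrier alg"
      using insert.prems insert.hyps(1) supp C0_zero
      by (auto simp: alg_carrier finite_subset b_def)
    have "P (b + KS_single e (a e))"
      using insert.prems b insert.IH[OF b supp] by (intro step) (auto simp: alg_carrier)
    moreover have "b + KS_single e (a e) = a" by (auto simp: b_def KS_single_def fun_eq_iff)
    ultimately show ?case by simp
  qed
  thus ?thesis using a by (auto simp: alg_carrier)
qed

lemma zero_in_alg: "0 \<in> sa_carrier alg"
  using C0_zero by (auto simp: alg_carrier KS_supp_def zero_fun_def)

text \<open>A C*-seminorm restricts to one on each summand, because \<open>e e = e\<close> makes the summand a
  subalgebra isomorphic to \<open>C0 (Y e)\<close>; there the supremum norm bounds it.\<close>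

lemma alg_seminorms_bounded:
  assumes "a \<in> sa_carrier alg"
  shows "\<exists>M. \<forall>p. cstar_seminorm alg p \<longrightarrow> p a \<le> M"
  using assms
proof (induction rule: alg_induct)
  case zero
  have "p 0 \<le> 0" if "cstar_seminorm alg p" for p
  proof -
    have "p (sa_scale alg 0 0) = cmod 0 * p 0"
      using that zero_in_alg unfolding cstar_seminorm_def by blast
    thus ?thesis by (simp add: alg_scale zero_fun_def)
  qed
  thus ?case by blast
next
  case (add_single a e g)
  then obtain M where M: "\<And>p. cstar_seminorm alg p \<Longrightarrow> p a \<le> M" by blast
  obtain K where K: "K > 0" "\<And>x. cmod (g x) \<le> K" using C0_bounded[OF add_single(3)] by blast
  have "p (a + KS_single e g) \<le> M + K" if p: "cstar_seminorm alg p" for p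
  proof -
    have ee: "e * e = e" using add_single(2) by (simp add: idempotents_def)
    have single: "KS_single e h \<in> sa_carrier alg" if "h \<in> C0 (Y e)" for h
      using that add_single(2) by (simp add: single_in_alg)
    have "p (KS_single e g) \<le> K"
    proof (rule C0_cstar_seminorm_le_sup[where q = "\<lambda>h. p (KS_single e h)", OF _ _ _ _ add_single(3) K])
      fix h assume h: "h \<in> C0 (Y e)"
      show "0 \<le> p (KS_single e h)" using p single[OF h] by (simp add: cstar_seminorm_def)
      show "p (KS_single e (\<lambda>x. c * h x)) = cmod c * p (KS_single e h)" for c
        using p single[OF h] by (simp add: cstar_seminorm_def single_scale)
      show "p (KS_single e (\<lambda>x. cnj (h x) * h x)) = (p (KS_single e h))\<^sup>2"
        using p single[OF h] single_mult[of e e "\<lambda>x. cnj (h x)" h]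
        by (simp add: cstar_seminorm_def single_star ee)
      show "p (KS_single e (\<lambda>x. h x + h' x)) \<le> p (KS_single e h) + p (KS_single e h')"
        if "h' \<in> C0 (Y e)" for h'
        using p single[OF h] single[OF that]
        by (simp add: cstar_seminorm_def single_add alg_add)
    qed
    moreover have "p (a + KS_single e g) \<le> p a + p (KS_single e g)"
      using p add_single(1) single[OF add_single(3)] by (simp add: cstar_seminorm_def alg_add)
    ultimately show ?thesis using M[OF p] by simp
  qed
  thus ?case by blast
qed

sublocale enveloped_star_algebra alg
proof
  fix a b d assume *: "a \<in> sa_carrier alg" "b \<in> sa_carrier alg" "d \<in> sa_carrier alg"
  have fin: "finite (KS_supp a \<union> KS_supp b)" "finite (KS_supp d)" using * by (auto simp: alg_carrier)
  have sub: "KS_supp (a + b) \<subseteq> KS_supp a \<union> KS_supp b" by (auto simp: KS_supp_def fun_eq_iff)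
  have split: "KS_single k (\<lambda>y. g y + h y) l x = KS_single k g l x + KS_single k h l x" for k g h l x
    by (simp add: KS_single_def)
  show "sa_mult alg (a + b) d = sa_mult alg a d + sa_mult alg b d"
    using alg_mult_superset[OF fin(1) _ fin(2) order_refl] sub
    by (intro ext) (simp add: distrib_right split sum.distrib)
  show "sa_mult alg d (a + b) = sa_mult alg d a + sa_mult alg d b"
    using alg_mult_superset[OF fin(2) order_refl fin(1)] sub
    by (intro ext) (simp add: distrib_left split sum.distrib)
qed (use zero_in_alg add_in_alg scale_in_alg mult_in_alg star_in_alg alg_seminorms_bounded in
    \<open>auto simp: alg_add alg_scale alg_star fun_eq_iff algebra_simps\<close>)


section \<open>Points and characters\<close>

abbreviation points :: "('s \<Rightarrow> 'x option) topology" where "points \<equiv> KS_space X \<theta>"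

lemma KS_product_iff: "\<tau> \<in> topspace (KS_product X \<theta>) \<longleftrightarrow>
    \<tau> \<in> (\<Pi>\<^sub>E e\<in>idempotents. topspace (Alexandroff_compactification (Y e)))"
  by (simp add: KS_product_def)

lemma points_iff: "\<tau> \<in> topspace points \<longleftrightarrow> \<tau> \<in> topspace (KS_product X \<theta>) \<and>
    (\<forall>e\<in>idempotents. \<forall>f\<in>idempotents. e * f = e \<and> \<tau> e \<noteq> None \<longrightarrow> \<tau> f = \<tau> e) \<and>
    (\<forall>e\<in>idempotents. \<forall>f\<in>idempotents. \<tau> e \<noteq> None \<and> \<tau> f \<noteq> None \<longrightarrow> \<tau> (e * f) \<noteq> None) \<and>
    (\<exists>e\<in>idempotents. \<tau> e \<noteq> None)"
proof -
  have le: "(\<forall>e\<in>idempotents. \<forall>f\<in>idempotents. natural_le e f \<and> \<tau> e \<noteq> None \<longrightarrow> \<tau> f = \<tau> e) \<longleftrightarrow>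
      (\<forall>e\<in>idempotents. \<forall>f\<in>idempotents. e * f = e \<and> \<tau> e \<noteq> None \<longrightarrow> \<tau> f = \<tau> e)"
    by (intro ball_cong refl) (simp add: natural_le_idempotents_iff)
  have inf: "\<tau> = (\<lambda>e\<in>idempotents. None) \<longleftrightarrow> \<not> (\<exists>e\<in>idempotents. \<tau> e \<noteq> None)"
    if "\<tau> \<in> topspace (KS_product X \<theta>)"
  proof
    assume "\<not> (\<exists>e\<in>idempotents. \<tau> e \<noteq> None)"
    thus "\<tau> = (\<lambda>e\<in>idempotents. None)"
      using that unfolding KS_product_iff by (intro extensionalityI[of _ idempotents]) (auto simp: PiE_def)
  qed simp
  show ?thesis
    unfolding KS_space_def KS_space_tilde_def topspace_subtopology Int_iff mem_Collect_eq le
      Compl_iff singleton_iff using inf by blast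
qed

lemma point_value:
  assumes "\<tau> \<in> topspace (KS_product X \<theta>)" "e \<in> idempotents" "\<tau> e = Some x"
  shows "x \<in> topspace (Y e)"
  using PiE_mem[OF assms(1)[unfolded KS_product_iff] assms(2)] assms(3) by auto

text \<open>The defining equation of both correspondences. As a relation it is symmetric in the two
  sides: \<open>KS_point\<close> and \<open>KS_char\<close> are its unique solutions for the other argument, which makes them
  mutually inverse.\<close>

definition corresponds :: "((nat \<Rightarrow> 's \<Rightarrow> 'x \<Rightarrow> complex) set \<Rightarrow> complex) \<Rightarrow> ('s \<Rightarrow> 'x option) \<Rightarrow> bool" where
  "corresponds \<phi> \<tau> \<longleftrightarrow>
     (\<forall>e\<in>idempotents. \<forall>g\<in>C0 (Y e). ext_infty g (\<tau> e) = \<phi> (KS_delta X \<theta> e g))"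

lemma Y_bump:
  assumes "e \<in> idempotents" "x \<in> topspace (Y e)"
  obtains g where "g \<in> C0 (Y e)" "g x = 1"
  using C0_bump[OF Y_spaces[OF assms(1)] openin_topspace assms(2)] by blast

lemma character_add_alg:
  assumes "\<phi> \<in> characters B" "a \<in> sa_carrier alg" "b \<in> sa_carrier alg"
  shows "\<phi> (enveloping_map alg (a + b)) = \<phi> (enveloping_map alg a) + \<phi> (enveloping_map alg b)"
  using character_cls(1)[OF assms(1) Cauchy_const[OF assms(2)] Cauchy_const[OF assms(3)]]
  by (simp add: enveloping_map_eq)

lemma character_zero_alg: "\<phi> \<in> characters B \<Longrightarrow> \<phi> (enveloping_map alg 0) = 0"
  using character_add_alg[OF _ zero_in_alg zero_in_alg, of \<phi>] by simp

lemma character_delta: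
  assumes \<phi>: "\<phi> \<in> characters B"
  defines "\<omega> \<equiv> \<lambda>e g. \<phi> (KS_delta X \<theta> e g)"
  assumes e: "e \<in> idempotents" and g: "g \<in> C0 (Y e)"
  shows "h \<in> C0 (Y e) \<Longrightarrow> \<omega> e (\<lambda>x. g x + h x) = \<omega> e g + \<omega> e h"
    and "\<omega> e (\<lambda>x. c * g x) = c * \<omega> e g"
    and "\<omega> e (\<lambda>x. cnj (g x)) = cnj (\<omega> e g)"
    and "f \<in> idempotents \<Longrightarrow> h \<in> C0 (Y f) \<Longrightarrow> \<omega> (e * f) (\<lambda>x. g x * h x) = \<omega> e g * \<omega> f h"
  using character_restrict[OF \<phi>] single_in_alg e g
  by (auto simp: \<omega>_def KS_delta_def characters_def single_add single_scale single_star single_mult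
      alg_add closed)

text \<open>The elements \<open>\<delta>\<^sub>e g\<close> span the algebra, and its image is dense in the completion.\<close>

lemma character_of_delta_unique:
  assumes \<phi>: "\<phi> \<in> characters B" and \<psi>: "\<psi> \<in> characters B"
    and eq: "\<And>e g. e \<in> idempotents \<Longrightarrow> g \<in> C0 (Y e) \<Longrightarrow> \<phi> (KS_delta X \<theta> e g) = \<psi> (KS_delta X \<theta> e g)"
  shows "\<phi> = \<psi>"
proof (rule characters_eqI[OF \<phi> \<psi>])
  fix a assume "a \<in> sa_carrier alg"
  thus "\<phi> (enveloping_map alg a) = \<psi> (enveloping_map alg a)"
  proof (induction rule: alg_induct)
    case zero
    show ?case by (simp only: character_zero_alg[OF \<phi>] character_zero_alg[OF \<psi>])
  next
    case (add_single a e g)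
    have single: "KS_single e g \<in> sa_carrier alg" using add_single by (simp add: single_in_alg)
    have "\<phi> (enveloping_map alg (KS_single e g)) = \<psi> (enveloping_map alg (KS_single e g))"
      using eq[of e g] add_single by (simp add: KS_delta_def)
    thus ?case
      by (simp only: character_add_alg[OF \<phi> add_single(1) single] character_add_alg[OF \<psi> add_single(1) single]
          add_single.IH)
  qed
qed

lemma corresponding_point_unique:
  assumes "\<tau> \<in> topspace (KS_product X \<theta>)" "\<sigma> \<in> topspace (KS_product X \<theta>)"
    and "corresponds \<phi> \<tau>" "corresponds \<phi> \<sigma>"
  shows "\<tau> = \<sigma>"
proof (rule PiE_ext[OF assms(1,2)[unfolded KS_product_iff]])
  fix e assume e: "e \<in> (idempotents :: 's set)"
  show "\<tau> e = \<sigma> e"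
    using PiE_mem[OF assms(1)[unfolded KS_product_iff] e] PiE_mem[OF assms(2)[unfolded KS_product_iff] e]
      assms(3,4) e
    by (intro C0_separates_points[OF Y_spaces[OF e]]) (auto simp: corresponds_def)
qed

text \<open>Each summand is a copy of \<open>C0 (Y e)\<close>, on which a character is evaluation at a point or zero,
  the latter being evaluation at infinity.\<close>

lemma corresponding_point_exists:
  assumes \<phi>: "\<phi> \<in> characters B"
  shows "\<exists>\<tau>\<in>topspace (KS_product X \<theta>). corresponds \<phi> \<tau>"
proof -
  have "\<exists>v\<in>topspace (Alexandroff_compactification (Y e)).
      \<forall>g\<in>C0 (Y e). ext_infty g v = \<phi> (KS_delta X \<theta> e g)" if e: "e \<in> idempotents" for e
  proof -
    have ee: "e * e = e" using e by (simp add: idempotents_def)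
    show ?thesis
      by (rule C0_multiplicative_functional_point[OF Y_spaces[OF e]])
         (use character_delta[OF \<phi> e] character_delta(4)[OF \<phi> e _ e] in \<open>simp_all add: ee\<close>)
  qed
  then obtain v where "\<And>e. e \<in> idempotents \<Longrightarrow> v e \<in> topspace (Alexandroff_compactification (Y e))"
    "\<And>e g. e \<in> idempotents \<Longrightarrow> g \<in> C0 (Y e) \<Longrightarrow> ext_infty g (v e) = \<phi> (KS_delta X \<theta> e g)"
    by metis
  thus ?thesis
    by (intro bexI[of _ "restrict v idempotents"])
       (auto simp: corresponds_def KS_product_iff simp del: topspace_Alexandroff_compactification)
qed

text \<open>The two conditions on \<open>\<tau>\<close> express the multiplication rule \<open>\<delta>\<^sub>e g \<cdot> \<delta>\<^sub>f h = \<delta>\<^sub>e\<^sub>f (g h)\<close>, tested on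
  functions with value 1 at the points in question. That \<open>\<tau>\<close> is not the point at infinity
  rests on automatic continuity: otherwise the character would vanish on the image of the
  algebra, which is dense.\<close>

lemma corresponding_point_in_points:
  assumes \<phi>: "\<phi> \<in> characters B" and \<tau>: "\<tau> \<in> topspace (KS_product X \<theta>)" and c: "corresponds \<phi> \<tau>"
  shows "\<tau> \<in> topspace points"
  unfolding points_iff
proof (intro conjI ballI impI)
  show "\<tau> \<in> topspace (KS_product X \<theta>)" by (rule \<tau>)
next
  fix e f :: 's
  assume ef: "e \<in> idempotents" "f \<in> idempotents" and *: "e * f = e \<and> \<tau> e \<noteq> None"
  obtain x where x: "\<tau> e = Some x" using * by blast
  note xY = point_value[OF \<tau> ef(1) x]
  obtain g where g: "g \<in> C0 (Y e)" "g x = 1" using Y_bump[OF ef(1) xY] by blast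
  have "act_dom \<theta> e \<subseteq> act_dom \<theta> f" using act_dom_mult[OF action ef] * by auto
  hence xf: "x \<in> topspace (Y f)" using xY by (simp add: topspace_Y ef subsetD)
  show "\<tau> f = \<tau> e"
  proof (rule C0_separates_points[OF Y_spaces[OF ef(2)]])
    fix h assume h: "h \<in> C0 (Y f)"
    have gh: "(\<lambda>x. g x * h x) \<in> C0 (Y e)" using C0_mult_Y[OF ef g(1) h] * by simp
    have "ext_infty g (\<tau> e) * ext_infty h (\<tau> f) = \<phi> (KS_delta X \<theta> e g) * \<phi> (KS_delta X \<theta> f h)"
      using c ef g(1) h by (simp add: corresponds_def)
    also have "\<dots> = \<phi> (KS_delta X \<theta> e (\<lambda>x. g x * h x))"
      using character_delta(4)[OF \<phi> ef(1) g(1) ef(2) h] * by simp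
    also have "\<dots> = ext_infty (\<lambda>x. g x * h x) (\<tau> e)" using c ef(1) gh by (simp add: corresponds_def)
    finally show "ext_infty h (\<tau> f) = ext_infty h (\<tau> e)" using g(2) by (simp add: x ext_infty_def)
  next
    show "\<tau> f \<in> topspace (Alexandroff_compactification (Y f))"
      using PiE_mem[OF \<tau>[unfolded KS_product_iff] ef(2)] .
    show "\<tau> e \<in> topspace (Alexandroff_compactification (Y f))" using xf by (simp add: x)
  qed
next
  fix e f :: 's
  assume ef: "e \<in> idempotents" "f \<in> idempotents" and *: "\<tau> e \<noteq> None \<and> \<tau> f \<noteq> None"
  obtain x y where xy: "\<tau> e = Some x" "\<tau> f = Some y" using * by blast
  obtain g where g: "g \<in> C0 (Y e)" "g x = 1" using Y_bump[OF ef(1) point_value[OF \<tau> ef(1) xy(1)]] by blast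
  obtain h where h: "h \<in> C0 (Y f)" "h y = 1" using Y_bump[OF ef(2) point_value[OF \<tau> ef(2) xy(2)]] by blast
  have "ext_infty (\<lambda>x. g x * h x) (\<tau> (e * f)) = \<phi> (KS_delta X \<theta> (e * f) (\<lambda>x. g x * h x))"
    using c C0_mult_Y[OF ef g(1) h(1)] idempotents_mult[OF ef] by (simp add: corresponds_def)
  also have "\<dots> = ext_infty g (\<tau> e) * ext_infty h (\<tau> f)"
    using character_delta(4)[OF \<phi> ef(1) g(1) ef(2) h(1)] c ef g(1) h(1) by (simp add: corresponds_def)
  finally have "ext_infty (\<lambda>x. g x * h x) (\<tau> (e * f)) = 1" using g(2) h(2) xy by (simp add: ext_infty_def)
  thus "\<tau> (e * f) \<noteq> None" by (metis ext_infty_def option.simps(4) zero_neq_one)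
next
  show "\<exists>e\<in>idempotents. \<tau> e \<noteq> None"
  proof (rule ccontr)
    assume "\<not> ?thesis"
    hence none: "\<phi> (KS_delta X \<theta> e g) = 0" if "e \<in> idempotents" "g \<in> C0 (Y e)" for e g
      using c that by (force simp: corresponds_def ext_infty_def)
    have "\<phi> (enveloping_map alg a) = 0" if "a \<in> sa_carrier alg" for a
      using that
    proof (induction rule: alg_induct)
      case zero
      show ?case by (rule character_zero_alg[OF \<phi>])
    next
      case (add_single a e g)
      have "\<phi> (enveloping_map alg (KS_single e g)) = 0"
        using none[of e g] add_single by (simp add: KS_delta_def)
      thus ?case
        by (simp only: character_add_alg[OF \<phi> add_single(1) single_in_alg[OF add_single(2,3)]]
            add_single.IH add_0_left)
    qed
    thus False using character_restrict[OF \<phi>] by (auto simp: characters_def)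
  qed
qed

text \<open>The functional \<open>\<Sum> \<delta>\<^sub>e g\<^sub>e \<mapsto> \<Sum> g\<^sub>e (\<tau> e)\<close> of a point.\<close>

definition functional :: "('s \<Rightarrow> 'x option) \<Rightarrow> ('s \<Rightarrow> 'x \<Rightarrow> complex) \<Rightarrow> complex" where
  "functional \<tau> a = (\<Sum>e\<in>KS_supp a. ext_infty (a e) (\<tau> e))"

lemma functional_superset:
  assumes "finite F" "KS_supp a \<subseteq> F"
  shows "functional \<tau> a = (\<Sum>e\<in>F. ext_infty (a e) (\<tau> e))"
  unfolding functional_def using assms
  by (intro sum.mono_neutral_left) (auto simp: KS_supp_def ext_infty_def split: option.splits)

lemma functional_single: "functional \<tau> (KS_single e g) = ext_infty g (\<tau> e)"
  by (subst functional_superset[of "{e}"]) (simp_all add: KS_supp_single single_apply)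

text \<open>The conditions on a point, in the form used for multiplicativity: \<open>\<tau> (e f)\<close> is finite
  exactly if \<open>\<tau> e\<close> and \<open>\<tau> f\<close> are, and then all three agree, because \<open>e f\<close> lies below both.\<close>

lemma ext_infty_mult_at_point:
  assumes "\<tau> \<in> topspace points" "e \<in> idempotents" "f \<in> idempotents"
  shows "ext_infty (\<lambda>x. g x * h x) (\<tau> (e * f)) = ext_infty g (\<tau> e) * ext_infty h (\<tau> f)"
proof (cases "\<tau> (e * f)")
  case None
  hence "\<tau> e = None \<or> \<tau> f = None" using assms unfolding points_iff by blast
  thus ?thesis using None by (auto simp: ext_infty_def)
next
  case (Some x)
  have ff: "f * f = f" and ee: "e * e = e" using assms by (simp_all add: idempotents_def)
  have "e * f * f = e * f" by (simp only: mult.assoc ff)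
  moreover have "e * f * e = e * f"
    by (metis idempotents_commute[OF assms(2,3)] mult.assoc ee)
  ultimately have "\<tau> f = \<tau> (e * f)" "\<tau> e = \<tau> (e * f)"
    using assms Some idempotents_mult[OF assms(2,3)] unfolding points_iff by blast+
  thus ?thesis using Some by (simp add: ext_infty_def)
qed

lemma functional_mult:
  assumes \<tau>: "\<tau> \<in> topspace points" and a: "a \<in> sa_carrier alg" and b: "b \<in> sa_carrier alg"
  shows "functional \<tau> (sa_mult alg a b) = functional \<tau> a * functional \<tau> b"
proof -
  define F where "F = (\<lambda>(e, f). e * f) ` (KS_supp a \<times> KS_supp b)"
  have F: "finite F" using a b by (simp add: F_def alg_carrier)
  have ext_sum: "ext_infty (\<lambda>x. \<Sum>i\<in>I. g i x) v = (\<Sum>i\<in>I. ext_infty (g i) v)"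
    for I :: "'s set" and g v by (cases v) (simp_all add: ext_infty_def)
  have "functional \<tau> (sa_mult alg a b) = (\<Sum>k\<in>F. ext_infty (sa_mult alg a b k) (\<tau> k))"
    using F KS_supp_mult[of a b] by (intro functional_superset) (auto simp: F_def)
  also have "\<dots> = (\<Sum>k\<in>F. \<Sum>e\<in>KS_supp a. \<Sum>f\<in>KS_supp b.
      ext_infty (KS_single (e * f) (\<lambda>y. a e y * b f y) k) (\<tau> k))"
    by (simp add: KS_alg_def ext_sum)
  also have "\<dots> = (\<Sum>e\<in>KS_supp a. \<Sum>f\<in>KS_supp b. \<Sum>k\<in>F.
      ext_infty (KS_single (e * f) (\<lambda>y. a e y * b f y) k) (\<tau> k))"
    by (subst sum.swap) (intro sum.cong refl sum.swap)
  also have "\<dots> = (\<Sum>e\<in>KS_supp a. \<Sum>f\<in>KS_supp b. ext_infty (a e) (\<tau> e) * ext_infty (b f) (\<tau> f))"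
  proof (intro sum.cong refl)
    fix e f assume ef: "e \<in> KS_supp a" "f \<in> KS_supp b"
    have "(\<Sum>k\<in>F. ext_infty (KS_single (e * f) (\<lambda>y. a e y * b f y) k) (\<tau> k)) =
        functional \<tau> (KS_single (e * f) (\<lambda>y. a e y * b f y))"
      using F ef KS_supp_single by (intro functional_superset[symmetric]) (force simp: F_def)+
    also have "\<dots> = ext_infty (a e) (\<tau> e) * ext_infty (b f) (\<tau> f)"
      using ef a b by (simp add: functional_single) (intro ext_infty_mult_at_point[OF \<tau>], auto simp: alg_carrier)
    finally show "(\<Sum>k\<in>F. ext_infty (KS_single (e * f) (\<lambda>y. a e y * b f y) k) (\<tau> k)) =
        ext_infty (a e) (\<tau> e) * ext_infty (b f) (\<tau> f)" .
  qed
  also have "\<dots> = functional \<tau> a * functional \<tau> b"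
    by (simp add: functional_def sum_product)
  finally show ?thesis .
qed

lemma functional_character:
  assumes \<tau>: "\<tau> \<in> topspace points"
  shows "restrict (functional \<tau>) (sa_carrier alg) \<in> characters alg"
proof -
  have add: "functional \<tau> (a + b) = functional \<tau> a + functional \<tau> b"
    if "a \<in> sa_carrier alg" "b \<in> sa_carrier alg" for a b
  proof -
    let ?F = "KS_supp a \<union> KS_supp b"
    have F: "finite ?F" using that by (simp add: alg_carrier)
    have "KS_supp (a + b) \<subseteq> ?F" by (auto simp: KS_supp_def fun_eq_iff)
    moreover have "ext_infty ((a + b) e) v = ext_infty (a e) v + ext_infty (b e) v" for e v
      by (cases v) (simp_all add: ext_infty_def)
    ultimately show ?thesis by (simp add: functional_superset[OF F] sum.distrib)
  qed
  have scale: "functional \<tau> (sa_scale alg c a) = c * functional \<tau> a"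
    and star: "functional \<tau> (sa_star alg a) = cnj (functional \<tau> a)"
    if "a \<in> sa_carrier alg" for a c
  proof -
    have F: "finite (KS_supp a)" using that by (simp add: alg_carrier)
    have "KS_supp (sa_scale alg c a) \<subseteq> KS_supp a" "KS_supp (sa_star alg a) \<subseteq> KS_supp a"
      by (auto simp: KS_supp_def fun_eq_iff alg_scale alg_star)
    moreover have "ext_infty (sa_scale alg c a e) v = c * ext_infty (a e) v"
      "ext_infty (sa_star alg a e) v = cnj (ext_infty (a e) v)" for e v
      by (cases v; simp add: ext_infty_def alg_scale alg_star)+
    ultimately show "functional \<tau> (sa_scale alg c a) = c * functional \<tau> a"
      "functional \<tau> (sa_star alg a) = cnj (functional \<tau> a)"
      by (simp_all add: functional_superset[OF F] sum_distrib_left)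
  qed
  have "\<exists>a\<in>sa_carrier alg. functional \<tau> a \<noteq> 0"
  proof -
    obtain e x where e: "e \<in> idempotents" "\<tau> e = Some x" using \<tau> unfolding points_iff by blast
    have "x \<in> topspace (Y e)" using point_value e \<tau> points_iff by blast
    then obtain g where "g \<in> C0 (Y e)" "g x = 1" using Y_bump[OF e(1)] by blast
    thus ?thesis using e by (intro bexI[of _ "KS_single e g"])
        (auto simp: functional_single ext_infty_def single_in_alg)
  qed
  thus ?thesis
    using add scale star functional_mult[OF \<tau>] by (auto simp: characters_def alg_add closed)
qed

lemma corresponding_character_exists:
  assumes \<tau>: "\<tau> \<in> topspace points"
  shows "\<exists>\<phi>\<in>characters B. corresponds \<phi> \<tau>"
proof -
  obtain \<phi> where \<phi>: "\<phi> \<in> characters B"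
    "\<And>a. a \<in> sa_carrier alg \<Longrightarrow> \<phi> (enveloping_map alg a) = restrict (functional \<tau>) (sa_carrier alg) a"
    using character_extend[OF functional_character[OF \<tau>]] by blast
  have "corresponds \<phi> \<tau>"
    unfolding corresponds_def KS_delta_def by (simp add: \<phi>(2) single_in_alg functional_single)
  thus ?thesis using \<phi>(1) by blast
qed

lemma KS_point_props:
  assumes \<phi>: "\<phi> \<in> characters B"
  shows "\<exists>!\<tau>. \<tau> \<in> topspace (KS_product X \<theta>) \<and> corresponds \<phi> \<tau>"
    and "KS_point X \<theta> \<phi> \<in> topspace points" and "corresponds \<phi> (KS_point X \<theta> \<phi>)"
proof -
  show ex1: "\<exists>!\<tau>. \<tau> \<in> topspace (KS_product X \<theta>) \<and> corresponds \<phi> \<tau>"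
    using corresponding_point_exists[OF \<phi>] corresponding_point_unique by blast
  have "KS_point X \<theta> \<phi> \<in> topspace (KS_product X \<theta>) \<and> corresponds \<phi> (KS_point X \<theta> \<phi>)"
    using theI'[OF ex1] by (simp add: KS_point_def corresponds_def)
  thus "KS_point X \<theta> \<phi> \<in> topspace points" "corresponds \<phi> (KS_point X \<theta> \<phi>)"
    using corresponding_point_in_points[OF \<phi>] by auto
qed

lemma KS_char_props:
  assumes \<tau>: "\<tau> \<in> topspace points"
  shows "\<exists>!\<phi>. \<phi> \<in> characters B \<and> corresponds \<phi> \<tau>"
    and "KS_char X \<theta> \<tau> \<in> characters B" and "corresponds (KS_char X \<theta> \<tau>) \<tau>"
proof -
  have "\<phi> = \<psi>" if "\<phi> \<in> characters B" "corresponds \<phi> \<tau>" "\<psi> \<in> characters B" "corresponds \<psi> \<tau>" for \<phi> \<psi>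
    using that by (intro character_of_delta_unique) (auto simp: corresponds_def)
  thus ex1: "\<exists>!\<phi>. \<phi> \<in> characters B \<and> corresponds \<phi> \<tau>"
    using corresponding_character_exists[OF \<tau>] by blast
  have "corresponds \<phi> \<tau> \<longleftrightarrow>
      (\<forall>e\<in>idempotents. \<forall>g\<in>C0 (Y e). \<phi> (KS_delta X \<theta> e g) = ext_infty g (\<tau> e))" for \<phi>
    by (auto simp: corresponds_def)
  thus "KS_char X \<theta> \<tau> \<in> characters B" "corresponds (KS_char X \<theta> \<tau>) \<tau>"
    using theI'[OF ex1] by (simp_all add: KS_char_def KS_cstar_def)
qed

lemma KS_char_KS_point: "\<phi> \<in> characters B \<Longrightarrow> KS_char X \<theta> (KS_point X \<theta> \<phi>) = \<phi>"
  using KS_point_props[of \<phi>] KS_char_props[of "KS_point X \<theta> \<phi>"] by blast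

lemma KS_point_KS_char: "\<tau> \<in> topspace points \<Longrightarrow> KS_point X \<theta> (KS_char X \<theta> \<tau>) = \<tau>"
  using KS_char_props[of \<tau>] KS_point_props[of "KS_char X \<theta> \<tau>"] points_iff by blast

text \<open>The coordinates are continuous because the one-point compactifications carry the weak
  topology of functions whose values at \<open>\<tau>\<^sub>\<phi> e\<close> are evaluations of \<open>\<phi>\<close>.\<close>

lemma continuous_KS_point: "continuous_map (Sp B) points (KS_point X \<theta>)"
proof -
  have pts: "KS_point X \<theta> \<phi> \<in> topspace points" if "\<phi> \<in> topspace (Sp B)" for \<phi>
    using that by (simp add: topspace_Sp KS_point_props)
  have "continuous_map (Sp B) (Alexandroff_compactification (Y e)) (\<lambda>\<phi>. KS_point X \<theta> \<phi> e)"
    if e: "e \<in> idempotents" for e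
  proof (rule continuous_map_into_Alexandroff[OF Y_spaces[OF e]])
    show "(\<lambda>\<phi>. KS_point X \<theta> \<phi> e) \<in> topspace (Sp B) \<rightarrow> topspace (Alexandroff_compactification (Y e))"
      using pts e unfolding points_iff KS_product_iff by (blast intro: PiE_mem)
    fix g assume g: "g \<in> C0 (Y e)"
    show "continuous_map (Sp B) euclidean (\<lambda>\<phi>. ext_infty g (KS_point X \<theta> \<phi> e))"
      by (rule continuous_map_eq[OF continuous_map_Sp_eval[OF single_in_alg[OF e g]]])
         (use KS_point_props(3) e g in \<open>simp add: topspace_Sp corresponds_def KS_delta_def\<close>)
  qed
  hence "continuous_map (Sp B) (KS_product X \<theta>) (KS_point X \<theta>)"
    using pts unfolding KS_product_def continuous_map_componentwise
    by (auto simp: points_iff KS_product_iff PiE_def)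
  moreover have "continuous_map (Sp B) (subtopology (subtopology P S) T) f"
    if "continuous_map (Sp B) P f"
      and "\<And>\<phi>. \<phi> \<in> topspace (Sp B) \<Longrightarrow> f \<phi> \<in> topspace (subtopology (subtopology P S) T)"
    for P :: "('s \<Rightarrow> 'x option) topology" and S T f
    using that by (auto simp: continuous_map_in_subtopology)
  ultimately show ?thesis
    using pts unfolding KS_space_def KS_space_tilde_def by blast
qed

text \<open>By \<open>continuous_map_into_Sp\<close> only the values on the span of the \<open>\<delta>\<^sub>e g\<close> matter, and those are
  sums of the continuous functions \<open>\<tau> \<mapsto> g (\<tau> e)\<close>.\<close>

lemma continuous_KS_char: "continuous_map points (Sp B) (KS_char X \<theta>)"
proof (rule continuous_map_into_Sp)
  fix a assume "a \<in> sa_carrier alg"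
  thus "continuous_map points euclidean (\<lambda>\<tau>. KS_char X \<theta> \<tau> (enveloping_map alg a))"
  proof (induction rule: alg_induct)
    case zero
    show ?case by (rule continuous_map_eq[of _ _ "\<lambda>_. 0"]) (simp, metis character_zero_alg KS_char_props(2))
  next
    case (add_single a e g)
    have "continuous_map points (Alexandroff_compactification (Y e)) (\<lambda>\<tau>. \<tau> e)"
      unfolding KS_space_def KS_space_tilde_def KS_product_def
      by (intro continuous_map_from_subtopology continuous_map_product_projection add_single)
    hence "continuous_map points euclidean (ext_infty g \<circ> (\<lambda>\<tau>. \<tau> e))"
      by (rule continuous_map_compose) (rule continuous_map_ext_infty[OF add_single(3)])
    hence "continuous_map points euclidean
        (\<lambda>\<tau>. KS_char X \<theta> \<tau> (enveloping_map alg a) + ext_infty g (\<tau> e))"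
      using add_single.IH by (intro continuous_map_add) (simp_all add: o_def)
    thus ?case
    proof (rule continuous_map_eq)
      fix \<tau> assume "\<tau> \<in> topspace points"
      note \<tau> = KS_char_props(2,3)[OF this]
      have "ext_infty g (\<tau> e) = KS_char X \<theta> \<tau> (enveloping_map alg (KS_single e g))"
        using \<tau>(2) add_single(2,3) by (simp add: corresponds_def KS_delta_def)
      thus "KS_char X \<theta> \<tau> (enveloping_map alg a) + ext_infty g (\<tau> e) =
          KS_char X \<theta> \<tau> (enveloping_map alg (a + KS_single e g))"
        using character_add_alg[OF \<tau>(1) add_single(1) single_in_alg[OF add_single(2,3)]] by simp
    qed
  qed
qed (rule KS_char_props)

end

theorem proposition4p1p1:
  fixes X :: "'x topology"
    and \<theta> :: "'s::inverse_semigroup \<Rightarrow> 'x \<Rightarrow> 'x option"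
  assumes "locally_compact_space X" and "Hausdorff_space X"
    and "semigroup_action X \<theta>"
  shows
    "(\<forall>\<phi>\<in>characters (KS_cstar X \<theta>).
        (\<exists>!\<tau>. \<tau> \<in> topspace (KS_product X \<theta>) \<and>
              (\<forall>e\<in>idempotents. \<forall>g\<in>C0 (act_space X \<theta> e).
                 ext_infty g (\<tau> e) = \<phi> (KS_delta X \<theta> e g))) \<and>
        KS_point X \<theta> \<phi> \<in> topspace (KS_space X \<theta>)) \<and>
     (\<forall>\<tau>\<in>topspace (KS_space X \<theta>).
        \<exists>!\<phi>. \<phi> \<in> characters (KS_cstar X \<theta>) \<and>
              (\<forall>e\<in>idempotents. \<forall>g\<in>C0 (act_space X \<theta> e).
                 \<phi> (KS_delta X \<theta> e g) = ext_infty g (\<tau> e))) \<and>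
     homeomorphic_maps (Sp (KS_cstar X \<theta>)) (KS_space X \<theta>) (KS_point X \<theta>) (KS_char X \<theta>)"
proof -
  interpret locally_compact_action X \<theta> using assms by unfold_locales
  have sym: "(\<forall>e\<in>idempotents. \<forall>g\<in>C0 (act_space X \<theta> e). \<phi> (KS_delta X \<theta> e g) = ext_infty g (\<tau> e))
      \<longleftrightarrow> corresponds \<phi> \<tau>" for \<phi> \<tau>
    by (auto simp: corresponds_def)
  show ?thesis
    unfolding KS_cstar_def sym corresponds_def[symmetric] homeomorphic_maps_def topspace_Sp
    by (intro conjI ballI KS_point_props(1,2) KS_char_props(1) continuous_KS_point continuous_KS_char
        KS_char_KS_point KS_point_KS_char)
qed

end
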